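(* For every integer $d\ge 2$ with $d\ne 3,5,7$, there exists a subgroup of $\mathrm{Aut}(\mathbb{T}^d)$ which is not virtually abelian, is mixing, and is not mixing of order $3$.
   Context: $\mathbb{T}^d=\mathbb{R}^d/\mathbb{Z}^d$ with normalized Haar measure $m$; $\mathcal{B}$ is the completion of its Borel $\sigma$-algebra; $\mathrm{Aut}(\mathbb{T}^d)$ is the group of continuous automorphisms. A group (or semigroup) $\Gamma$ of epimorphisms is mixing if for all $A,B\in\mathcal{B}$, $m(A\cap\gamma^{-1}B)\to m(A)m(B)$ as $\gamma\to\infty$ in $\Gamma$ (i.e. as $\gamma$ leaves every finite subset of $\Gamma$). It is mixing of order $s$ if for all $B_1,\ldots,B_s\in\mathcal{B}$, $m(\gamma_1^{-1}B_1\cap(\gamma_2\gamma_1)^{-1}B_2\cap\cdots\cap(\gamma_s\cdots\gamma_1)^{-1}B_s)\to m(B_1)\cdots m(B_s)$ as the products $\gamma_j\cdots\gamma_i\to\infty$ for all $1<i\le j\le s$, where $\gamma_1,\ldots,\gamma_s\in\Gamma$; that is, for every $\varepsilon>0$ there is a finite $K\subset\Gamma$ such that the two sides differ by less than $\varepsilon$ whenever $\gamma_j\cdots\gamma_i\notin K$ for all $1<i\le j\le s$. A group is virtually abelian if it has an abelian subgroup of finite index. *)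

theory Defs
  imports "HOL-Probability.Probability" "HOL-Algebra.Coset"
begin

definition torus_rel :: "real ^ 'n \<Rightarrow> real ^ 'n \<Rightarrow> bool" where
  "torus_rel x y \<longleftrightarrow> (\<forall>i. x $ i - y $ i \<in> \<int>)"

lemma diff_diff_diff: "(a - b) - (c - d) = (a - c) - (b - d)" for a b c d :: real
  by simp

lemma equivp_torus_rel: "equivp torus_rel"
proof (rule equivpI)
  show "reflp torus_rel" by (simp add: reflp_def torus_rel_def)
  show "symp torus_rel"
    unfolding symp_def torus_rel_def using minus_in_Ints_iff minus_diff_eq by metis
  show "transp torus_rel"
  proof (rule transpI)
    fix x y z :: "real ^ 'n" assume a: "torus_rel x y" "torus_rel y z"
    show "torus_rel x z" unfolding torus_rel_def
    proof
      fix i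
      have "(x $ i - y $ i) + (y $ i - z $ i) \<in> \<int>"
        using a unfolding torus_rel_def by (intro Ints_add) auto
      then show "x $ i - z $ i \<in> \<int>" by simp
    qed
  qed
qed

quotient_type 'n torus = "real ^ 'n" / torus_rel
  morphisms rep_torus to_torus
  by (rule equivp_torus_rel)

instantiation torus :: (finite) ab_group_add
begin

lift_definition zero_torus :: "'a torus" is 0 .

lift_definition plus_torus :: "'a torus \<Rightarrow> 'a torus \<Rightarrow> 'a torus" is "(+)"
  by (simp only: torus_rel_def vector_add_component add_diff_add Ints_add simp_thms)

lift_definition uminus_torus :: "'a torus \<Rightarrow> 'a torus" is uminus
  by (simp only: torus_rel_def vector_uminus_component minus_diff_minus Ints_minus simp_thms)

lift_definition minus_torus :: "'a torus \<Rightarrow> 'a torus \<Rightarrow> 'a torus" is "(-)"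
  by (simp only: torus_rel_def vector_minus_component diff_diff_diff Ints_diff simp_thms)

instance
  by standard (transfer; simp add: torus_rel_def algebra_simps)+

end

text \<open>Quotient topology of \<open>\<real>\<^sup>d\<close>.\<close>

instantiation torus :: (finite) topological_space
begin

definition open_torus :: "'a torus set \<Rightarrow> bool" where
  "open_torus U \<longleftrightarrow> open (to_torus -` U)"

instance
  by standard (auto simp: open_torus_def vimage_Union)

end

lemma to_torus_eq_iff: "to_torus x = to_torus y \<longleftrightarrow> torus_rel x y"
  by (rule torus.abs_eq_iff)

lemma to_torus_add: "to_torus (x + y) = to_torus x + to_torus y"
  by (rule plus_torus.abs_eq[symmetric])

lemma continuous_to_torus: "continuous_on UNIV to_torus"
  by (simp add: continuous_on_open_vimage open_torus_def)

lemma measurable_to_torus [measurable]: "to_torus \<in> borel_measurable borel"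
  by (rule borel_measurable_continuous_onI[OF continuous_to_torus])

definition unit_cube :: "(real ^ 'n) set" where
  "unit_cube = {x. \<forall>i. 0 \<le> x $ i \<and> x $ i < 1}"

text \<open>
  The cube is a fundamental domain for \<open>\<int>\<^sup>d\<close>. That this image of Lebesgue measure is the
  normalised Haar measure is \<open>prob_space_torus_haar\<close> with \<open>torus_haar_translation\<close> below.
\<close>

definition torus_haar :: "'n::finite torus measure" where
  "torus_haar = distr (restrict_space lborel unit_cube) borel to_torus"

lemma unit_cube_borel [measurable]: "unit_cube \<in> sets (borel :: (real ^ 'n::finite) measure)"
proof -
  have "{x. \<forall>i\<in>UNIV. 0 \<le> x $ i \<and> x $ i < 1} \<in> sets (borel :: (real ^ 'n) measure)"
    by measurable
  then show ?thesis by (simp add: unit_cube_def)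
qed

lemma sets_torus_haar [simp, measurable_cong]: "sets torus_haar = sets borel"
  by (simp add: torus_haar_def)

lemma space_torus_haar [simp]: "space torus_haar = UNIV"
  by (simp add: torus_haar_def)

lemma emeasure_torus_haar:
  fixes A :: "'n::finite torus set"
  assumes "A \<in> sets borel"
  shows "emeasure torus_haar A = emeasure lborel (unit_cube \<inter> to_torus -` A)"
proof -
  have m: "to_torus \<in> measurable (restrict_space lborel unit_cube) borel"
    by (rule measurable_restrict_space1) simp
  have "emeasure torus_haar A =
      emeasure (restrict_space lborel unit_cube) (to_torus -` A \<inter> unit_cube)"
    unfolding torus_haar_def using assms m
    by (subst emeasure_distr) (simp_all add: space_restrict_space)
  also have "\<dots> = emeasure lborel (to_torus -` A \<inter> unit_cube)"
    by (rule emeasure_restrict_space) auto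
  finally show ?thesis by (simp add: Int_commute)
qed

lemma emeasure_unit_cube: "emeasure lborel (unit_cube :: (real ^ 'n::finite) set) = 1"
proof -
  let ?b = "(\<chi> i. 1) :: real ^ 'n"
  have D: "(\<Prod>b\<in>Basis. (?b - 0) \<bullet> b) = 1"
    by (intro prod.neutral) (auto simp: Basis_vec_def inner_axis)
  have le: "\<forall>b\<in>Basis. (0 :: real ^ 'n) \<bullet> b \<le> ?b \<bullet> b"
    by (auto simp: Basis_vec_def inner_axis)
  have 1: "emeasure lborel (box 0 ?b) = 1" "emeasure lborel (cbox 0 ?b) = 1"
    using D le by (simp_all add: emeasure_lborel_box_eq emeasure_lborel_cbox_eq)
  have "box 0 ?b \<subseteq> unit_cube" "unit_cube \<subseteq> cbox 0 ?b"
    by (auto simp: unit_cube_def mem_box_cart less_imp_le)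
  then have "emeasure lborel (box 0 ?b) \<le> emeasure lborel (unit_cube :: (real ^ 'n) set)"
    "emeasure lborel (unit_cube :: (real ^ 'n) set) \<le> emeasure lborel (cbox 0 ?b)"
    by (intro emeasure_mono; simp)+
  then show ?thesis using 1 by simp
qed

lemma prob_space_torus_haar: "prob_space torus_haar"
  by (rule prob_spaceI) (simp add: emeasure_torus_haar emeasure_unit_cube)

lemma emeasure_lborel_shift:
  fixes S :: "(real ^ 'n::finite) set"
  assumes "S \<in> sets borel"
  shows "emeasure lborel {x. c + x \<in> S} = emeasure lborel S"
proof -
  have "emeasure lborel S = emeasure (distr lborel borel ((+) c)) S"
    by (simp add: lborel_distr_plus)
  also have "\<dots> = emeasure lborel {x. c + x \<in> S}"
    using assms by (subst emeasure_distr) (simp_all add: vimage_def)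
  finally show ?thesis by simp
qed

lemma emeasure_translated_cube:
  fixes P :: "(real ^ 'n::finite) set"
  assumes P: "P \<in> sets borel"
    and per: "\<And>x k. (\<forall>i. k $ i \<in> \<int>) \<Longrightarrow> k + x \<in> P \<longleftrightarrow> x \<in> P"
  shows "emeasure lborel ({x. x - a \<in> unit_cube} \<inter> P) = emeasure lborel (unit_cube \<inter> P)"
proof -
  define Z where "Z = {k :: real ^ 'n. \<forall>i. k $ i \<in> \<int>}"
  define Q where "Q k = {x :: real ^ 'n. x - k \<in> unit_cube}" for k
  have Qm [measurable]: "Q k \<in> sets borel" for k
    unfolding Q_def by measurable
  have Zc: "countable Z"
  proof -
    have "Z \<subseteq> (\<lambda>f. \<chi> i. real_of_int (f i)) ` (UNIV :: ('n \<Rightarrow> int) set)"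
    proof
      fix k assume "k \<in> Z"
      then have "k = (\<chi> i. real_of_int \<lfloor>k $ i\<rfloor>)"
        by (simp add: Z_def vec_eq_iff)
      then show "k \<in> (\<lambda>f. \<chi> i. real_of_int (f i)) ` (UNIV :: ('n \<Rightarrow> int) set)"
        by (rule image_eqI[where x = "\<lambda>i. \<lfloor>k $ i\<rfloor>"]) simp
    qed
    moreover have "countable (UNIV :: ('n \<Rightarrow> int) set)"
      by (simp add: countableI_type)
    ultimately show ?thesis by (meson countable_image countable_subset)
  qed
  have ex: "\<exists>k\<in>Z. x - k \<in> unit_cube" for x
    by (rule bexI[of _ "\<chi> i. real_of_int \<lfloor>x $ i\<rfloor>"])
      (auto simp: Z_def unit_cube_def; linarith)+
  have uniq: "k = l" if kl: "k \<in> Z" "l \<in> Z" "x - k \<in> unit_cube" "x - l \<in> unit_cube" for x k l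
  proof -
    have "k $ i = l $ i" for i
    proof -
      obtain m n where mn: "k $ i = of_int m" "l $ i = of_int n"
        using kl(1,2) unfolding Z_def mem_Collect_eq by (metis Ints_cases)
      have "0 \<le> x $ i - k $ i" "x $ i - k $ i < 1" "0 \<le> x $ i - l $ i" "x $ i - l $ i < 1"
        using kl(3,4) by (auto simp: unit_cube_def)
      then have "m = n" unfolding mn by linarith
      then show ?thesis by (simp add: mn)
    qed
    then show ?thesis by (simp add: vec_eq_iff)
  qed
  have "emeasure lborel (Q a \<inter> P) = emeasure lborel (\<Union>k\<in>Z. Q a \<inter> Q k \<inter> P)"
    using ex by (intro arg_cong[where f = "emeasure lborel"]) (auto simp: Q_def)
  also have "\<dots> = (\<integral>\<^sup>+k. emeasure lborel (Q a \<inter> Q k \<inter> P) \<partial>count_space Z)"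
    using P Zc uniq by (intro emeasure_UN_countable) (auto simp: disjoint_family_on_def Q_def[of k for k])
  also have "\<dots> = (\<integral>\<^sup>+k. emeasure lborel (Q (a - k) \<inter> unit_cube \<inter> P) \<partial>count_space Z)"
  proof (rule nn_integral_cong)
    fix k assume "k \<in> space (count_space Z)"
    then have k: "\<forall>i. k $ i \<in> \<int>" by (simp add: Z_def)
    have "{x. k + x \<in> Q a \<inter> Q k \<inter> P} = Q (a - k) \<inter> unit_cube \<inter> P"
      using per[OF k] by (auto simp: Q_def algebra_simps)
    then show "emeasure lborel (Q a \<inter> Q k \<inter> P) = emeasure lborel (Q (a - k) \<inter> unit_cube \<inter> P)"
      using emeasure_lborel_shift[of "Q a \<inter> Q k \<inter> P" k] P by simp
  qed
  also have "\<dots> = emeasure lborel (\<Union>k\<in>Z. Q (a - k) \<inter> unit_cube \<inter> P)"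
  proof (rule emeasure_UN_countable[symmetric])
    show "disjoint_family_on (\<lambda>k. Q (a - k) \<inter> unit_cube \<inter> P) Z"
      unfolding disjoint_family_on_def
    proof (intro ballI impI, rule ccontr)
      fix k l assume kl: "k \<in> Z" "l \<in> Z" "k \<noteq> l"
        "Q (a - k) \<inter> unit_cube \<inter> P \<inter> (Q (a - l) \<inter> unit_cube \<inter> P) \<noteq> {}"
      then obtain x where "x - a - (- k) \<in> unit_cube" "x - a - (- l) \<in> unit_cube"
        by (auto simp: Q_def algebra_simps)
      moreover have "- k \<in> Z" "- l \<in> Z" using kl by (auto simp: Z_def)
      ultimately show False using uniq[of "- k" "- l"] kl by auto
    qed
  qed (use P Zc in auto)
  also have "(\<Union>k\<in>Z. Q (a - k) \<inter> unit_cube \<inter> P) = unit_cube \<inter> P"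
  proof -
    have "\<exists>k\<in>Z. x \<in> Q (a - k)" for x
    proof -
      obtain k where "k \<in> Z" "x - a - k \<in> unit_cube" using ex by blast
      then show ?thesis
        by (intro bexI[of _ "- k"]) (auto simp: Q_def Z_def algebra_simps)
    qed
    then show ?thesis by auto
  qed
  finally show ?thesis by (simp add: Q_def)
qed

lemma measurable_torus_shift [measurable]:
  "(+) (a :: 'n::finite torus) \<in> borel_measurable borel"
proof (rule borel_measurable_continuous_onI)
  show "continuous_on UNIV ((+) a)"
    unfolding continuous_on_open_vimage[OF open_UNIV]
  proof (intro allI impI)
    fix U :: "'n torus set" assume U: "open U"
    obtain r where r: "a = to_torus r"
      by (metis Quotient_abs_rep Quotient_torus)
    have "to_torus -` ((+) a -` U) = (+) r -` (to_torus -` U)"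
      by (auto simp: r to_torus_add)
    moreover have "open ((+) r -` (to_torus -` U))"
    proof (rule open_vimage)
      show "open (to_torus -` U)" using U by (simp add: open_torus_def)
      show "continuous_on UNIV ((+) r)" by (intro continuous_intros)
    qed
    ultimately show "open ((+) a -` U \<inter> UNIV)" by (simp add: open_torus_def)
  qed
qed

lemma torus_haar_translation: "distr torus_haar borel ((+) a) = torus_haar"
proof (rule measure_eqI)
  fix A assume "A \<in> sets (distr torus_haar borel ((+) a))"
  then have A: "A \<in> sets borel" by simp
  obtain r where r: "a = to_torus r"
    by (metis Quotient_abs_rep Quotient_torus)
  let ?P = "to_torus -` A"
  have P: "?P \<in> sets borel"
    using measurable_sets[OF measurable_to_torus A] by simp
  have per: "k + x \<in> ?P \<longleftrightarrow> x \<in> ?P" if "\<forall>i. k $ i \<in> \<int>" for k x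
  proof -
    have "to_torus (k + x) = to_torus x"
      using that by (simp add: to_torus_eq_iff torus_rel_def)
    then show ?thesis by simp
  qed
  have sA: "(+) a -` A \<in> sets borel"
    using measurable_sets[OF measurable_torus_shift A] by simp
  have c: "{x. x - r \<in> unit_cube} \<in> sets borel" by measurable
  have "emeasure (distr torus_haar borel ((+) a)) A = emeasure torus_haar ((+) a -` A)"
    using A by (subst emeasure_distr) auto
  also have "\<dots> = emeasure lborel (unit_cube \<inter> to_torus -` ((+) a -` A))"
    by (rule emeasure_torus_haar[OF sA])
  also have "unit_cube \<inter> to_torus -` ((+) a -` A) =
      {x. r + x \<in> {x. x - r \<in> unit_cube} \<inter> ?P}"
    by (auto simp: r to_torus_add)
  also have "emeasure lborel \<dots> = emeasure lborel ({x. x - r \<in> unit_cube} \<inter> ?P)"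
    using P c by (intro emeasure_lborel_shift) auto
  also have "\<dots> = emeasure lborel (unit_cube \<inter> ?P)"
    by (rule emeasure_translated_cube[OF P per])
  also have "\<dots> = emeasure torus_haar A"
    by (rule emeasure_torus_haar[OF A, symmetric])
  finally show "emeasure (distr torus_haar borel ((+) a)) A = emeasure torus_haar A" .
qed simp

abbreviation torus_measure :: "'n::finite torus measure" where
  "torus_measure \<equiv> completion torus_haar"

definition torus_Aut :: "('n::finite torus \<Rightarrow> 'n torus) monoid" where
  "torus_Aut = \<lparr>carrier = {f. (\<forall>x y. f (x + y) = f x + f y) \<and> (\<exists>g. homeomorphism UNIV UNIV f g)},
     mult = (\<circ>), one = id\<rparr>"

lemma group_torus_Aut: "group (torus_Aut :: ('n::finite torus \<Rightarrow> 'n torus) monoid)"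
proof (rule groupI)
  fix f :: "'n torus \<Rightarrow> 'n torus" assume "f \<in> carrier torus_Aut"
  then obtain g where f: "\<forall>x y. f (x + y) = f x + f y" and g: "homeomorphism UNIV UNIV f g"
    by (auto simp: torus_Aut_def)
  have inv: "f (g x) = x" "g (f x) = x" for x
    using g by (auto simp: homeomorphism_def)
  have "g (x + y) = g x + g y" for x y
    by (metis f inv)
  moreover have "homeomorphism UNIV UNIV g f"
    using g by (rule homeomorphism_symD)
  ultimately show "\<exists>h\<in>carrier torus_Aut. h \<otimes>\<^bsub>torus_Aut\<^esub> f = \<one>\<^bsub>torus_Aut\<^esub>"
    by (intro bexI[of _ g]) (auto simp: torus_Aut_def fun_eq_iff inv)
next
  fix f g :: "'n torus \<Rightarrow> 'n torus"
  assume fg: "f \<in> carrier torus_Aut" "g \<in> carrier torus_Aut"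
  then obtain f' g' where "homeomorphism UNIV UNIV f f'" "homeomorphism UNIV UNIV g g'"
    by (auto simp: torus_Aut_def)
  then have "homeomorphism UNIV UNIV (f \<circ> g) (g' \<circ> f')"
    by (intro homeomorphism_compose)
  then show "f \<otimes>\<^bsub>torus_Aut\<^esub> g \<in> carrier torus_Aut"
    using fg by (auto simp: torus_Aut_def)
next
  show "\<one>\<^bsub>torus_Aut\<^esub> \<in> carrier torus_Aut"
    using homeomorphism_ident by (auto simp: torus_Aut_def id_def)
qed (auto simp: torus_Aut_def)

definition virtually_abelian :: "('a, 'b) monoid_scheme \<Rightarrow> bool" where
  "virtually_abelian G \<longleftrightarrow>
     (\<exists>H. subgroup H G \<and> comm_group (G\<lparr>carrier := H\<rparr>) \<and> finite (rcosets\<^bsub>G\<^esub> H))"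

definition mixing :: "'a measure \<Rightarrow> ('a \<Rightarrow> 'a) set \<Rightarrow> bool" where
  "mixing M \<Gamma> \<longleftrightarrow>
     (\<forall>A\<in>sets M. \<forall>B\<in>sets M.
        ((\<lambda>\<gamma>. measure M (A \<inter> (\<gamma> -` B \<inter> space M))) \<longlongrightarrow> measure M A * measure M B)
          (inf cofinite (principal \<Gamma>)))"

text \<open>\<open>iterated_comp \<gamma> i j\<close> is \<open>\<gamma> j \<circ> \<dots> \<circ> \<gamma> i\<close>, for \<open>i \<le> j\<close>.\<close>

definition iterated_comp :: "(nat \<Rightarrow> 'a \<Rightarrow> 'a) \<Rightarrow> nat \<Rightarrow> nat \<Rightarrow> 'a \<Rightarrow> 'a" where
  "iterated_comp \<gamma> i j = fold (\<lambda>k f. \<gamma> k \<circ> f) [i..<Suc j] id"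

lemma iterated_comp_same: "iterated_comp \<gamma> i i = \<gamma> i"
  by (simp add: iterated_comp_def)

lemma iterated_comp_Suc:
  "i \<le> j \<Longrightarrow> iterated_comp \<gamma> i (Suc j) = \<gamma> (Suc j) \<circ> iterated_comp \<gamma> i j"
  by (simp add: iterated_comp_def)

definition mixing_of_order :: "nat \<Rightarrow> 'a measure \<Rightarrow> ('a \<Rightarrow> 'a) set \<Rightarrow> bool" where
  "mixing_of_order s M \<Gamma> \<longleftrightarrow>
     (\<forall>B. (\<forall>i\<in>{1..s}. B i \<in> sets M) \<longrightarrow>
       (\<forall>\<epsilon>>0. \<exists>K. finite K \<and> K \<subseteq> \<Gamma> \<and>
         (\<forall>\<gamma>. (\<forall>i\<in>{1..s}. \<gamma> i \<in> \<Gamma>) \<longrightarrow>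
              (\<forall>i j. 1 < i \<and> i \<le> j \<and> j \<le> s \<longrightarrow> iterated_comp \<gamma> i j \<notin> K) \<longrightarrow>
              \<bar>measure M {x\<in>space M. \<forall>i\<in>{1..s}. iterated_comp \<gamma> 1 i x \<in> B i}
                - (\<Prod>i\<in>{1..s}. measure M (B i))\<bar> < \<epsilon>)))"

end

theory Submission
  imports Defs "HOL-Complex_Analysis.Cauchy_Integral_Theorem" "HOL-Library.Function_Algebras"
begin

text \<open>
  An automorphism group of the torus corresponds to a group \<open>G\<close> of automorphisms of the lattice of
  characters. If nontrivial elements of \<open>G\<close> fix no nonzero character, then at most one element
  carries a given nonzero character to another, and approximation by trigonometric polynomials
  gives mixing. A relation \<open>a + f b + f\<^sup>r c = 0\<close> among nonzero characters that persists under
  conjugation of \<open>f\<close> by the powers of some \<open>g\<close> gives infinitely many relations between three characters,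
  and so destroys mixing of order 3.

  A free group of hyperbolic matrices in \<open>SL\<^sub>2(\<int>)\<close> without parabolic elements satisfies all this: by
  Cayley-Hamilton, \<open>1 - t f + f\<^sup>2 = 0\<close> for all conjugates of \<open>f\<close>. Diagonal actions settle even \<open>d\<close>. In
  dimension 9, the units of an order in a cyclic division algebra of degree 3 act freely by left
  multiplication, and the order contains the unit \<open>\<alpha>\<close> with \<open>1 - 3 \<alpha> + \<alpha>\<^sup>3 = 0\<close>. Two of its units
  generate a free group, by ping-pong in three-dimensional real space; letting this free group act
  on the order and simultaneously on \<open>k\<close> copies of \<open>\<int>\<^sup>2\<close> settles \<open>d = 9 + 2 k\<close>.
\<close>

subsection \<open>Characters and trigonometric polynomials\<close>

text \<open>The relation is a polynomial identity satisfied by \<open>f\<close> with integer, hence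
  central, coefficients, so every conjugate of \<open>f\<close> satisfies it too. If some positive
  power of \<open>g\<close> commuted with \<open>f\<close>, only finitely many conjugates would
  arise; noncommutativity is the source of infinitely many relations. The obstacle is freeness. An
  element of infinite order that fixes a nonzero character already destroys mixing, so eigenvalue 1
  is forbidden for all nontrivial elements. If one abstract group acts on several lattices without
  nonzero fixed vectors, it does so on their direct sum, hence ranks add. Rank 2 gives all even
  dimensions; an odd dimension needs one summand of odd rank, and an order in a division algebra of
  degree 3 has rank 9. This is why 3, 5 and 7 stay out of reach of the construction. Above dimension
  9 the relation can be placed in a summand \<open>\<int>\<^sup>2\<close>, and the order only has to
  be acted on freely. In dimension 9 the relation must come from the order itself.\<close>

definition ip :: "int ^ 'n::finite \<Rightarrow> real ^ 'n \<Rightarrow> real" where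
  "ip v x = (\<Sum>j\<in>UNIV. of_int (v $ j) * x $ j)"

lemma ip_add_left: "ip (v + w) x = ip v x + ip w x"
  and ip_add_right: "ip v (x + y) = ip v x + ip v y"
  and ip_diff_right: "ip v (x - y) = ip v x - ip v y"
  and ip_scale_right: "ip v (c *\<^sub>R x) = c * ip v x"
  and ip_zero_left [simp]: "ip 0 x = 0"
  and ip_minus_left: "ip (- v) x = - ip v x"
  by (simp_all add: ip_def sum.distrib algebra_simps sum_subtractf sum_negf sum_distrib_left)

lemma ip_axis_left: "ip (axis i 1) x = x $ i"
  by (simp add: ip_def axis_def if_distrib if_distribR cong: if_cong)

text \<open>Along the line through \<open>v\<close> the pairing with \<open>v\<close> takes every
  real value; points of the torus where \<open>chr v\<close> has a prescribed value are found
  there.\<close>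

lemma ip_self_pos:
  assumes "v \<noteq> 0"
  shows "0 < ip v (\<chi> j. of_int (v $ j))"
proof -
  obtain j where "v $ j \<noteq> 0" using assms by (auto simp: vec_eq_iff)
  then have "0 < real_of_int (v $ j) * real_of_int (v $ j)"
    by (simp add: zero_less_mult_iff linorder_neq_iff) linarith
  moreover have "\<dots> \<le> (\<Sum>j\<in>UNIV. real_of_int (v $ j) * real_of_int (v $ j))"
    by (rule member_le_sum) auto
  ultimately show ?thesis by (simp add: ip_def)
qed

lemma continuous_on_ip [continuous_intros]:
  "continuous_on S f \<Longrightarrow> continuous_on S (\<lambda>x. ip v (f x))"
  unfolding ip_def by (intro continuous_intros)

lemma ip_Ints: "(\<And>j. x $ j \<in> \<int>) \<Longrightarrow> ip v x \<in> \<int>"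
  unfolding ip_def by (intro Ints_sum Ints_mult) auto

lemma cis_2pi_Ints: "a \<in> \<int> \<Longrightarrow> cis (2 * pi * a) = 1"
  by (rule cis_multiple_2pi)

lift_definition chr :: "int ^ 'n::finite \<Rightarrow> 'n torus \<Rightarrow> complex" is
  "\<lambda>v x. cis (2 * pi * ip v x)"
proof -
  fix v :: "int ^ 'n" and x y :: "real ^ 'n" assume "torus_rel x y"
  then have "ip v (x - y) \<in> \<int>"
    by (intro ip_Ints) (simp add: torus_rel_def)
  then have "cis (2 * pi * ip v (x - y)) = 1" by (rule cis_2pi_Ints)
  then have "cis (2 * pi * ip v y) * cis (2 * pi * ip v (x - y)) = cis (2 * pi * ip v y)" by simp
  then show "cis (2 * pi * ip v x) = cis (2 * pi * ip v y)"
    by (simp add: cis_mult ip_diff_right algebra_simps)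
qed

lemma chr_to_torus: "chr v (to_torus x) = cis (2 * pi * ip v x)"
  by (rule chr.abs_eq)

lemma chr_add: "chr v (s + t) = chr v s * chr v t"
  by transfer (simp add: cis_mult ip_add_right algebra_simps)

lemma chr_add_index: "chr (v + w) t = chr v t * chr w t"
  by transfer (simp add: cis_mult ip_add_left algebra_simps)

lemma chr_zero [simp]: "chr 0 t = 1"
  by transfer simp

lemma chr_uminus: "chr (- v) t = cnj (chr v t)"
  by transfer (simp add: cis_cnj ip_minus_left)

lemma norm_chr [simp]: "norm (chr v t) = 1"
  by transfer simp

lemma torus_cases: obtains x where "t = to_torus x"
  by (metis Quotient_abs_rep Quotient_torus)

lemma continuous_on_torusI:
  fixes f :: "'n::finite torus \<Rightarrow> 'a::topological_space"
  assumes "continuous_on UNIV (\<lambda>x. f (to_torus x))"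
  shows "continuous_on UNIV f"
  using assms unfolding continuous_on_open_vimage[OF open_UNIV]
  by (simp add: open_torus_def vimage_def)

lemma continuous_on_chr: "continuous_on UNIV (chr v)"
  by (rule continuous_on_torusI, unfold chr_to_torus, unfold cis_conv_exp)
     (intro continuous_intros)

lemma measurable_chr [measurable]: "chr v \<in> borel_measurable borel"
  by (rule borel_measurable_continuous_onI[OF continuous_on_chr])

interpretation haar: prob_space "torus_haar :: 'n::finite torus measure"
  by (rule prob_space_torus_haar)

lemma measure_haar_UNIV: "measure (torus_haar :: 'n::finite torus measure) UNIV = 1"
  using haar.prob_space[where 'n = 'n] by simp

lemma integrable_haar_bounded:
  fixes f :: "'n::finite torus \<Rightarrow> 'a::{banach, second_countable_topology}"
  assumes "f \<in> borel_measurable borel" "\<And>t. norm (f t) \<le> B"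
  shows "integrable torus_haar f"
  using assms by (intro haar.integrable_const_bound[where B = B]) auto

text \<open>Translation by a point where the character equals -1 turns the integral into its
  negative. Such a point lies on the line through \<open>v\<close>, at pairing 1/2.\<close>

lemma integral_chr:
  "(\<integral>t. chr v t \<partial>torus_haar) = (if v = 0 then 1 else 0)"
proof (cases "v = 0")
  case False
  let ?I = "\<integral>t. chr v t \<partial>torus_haar"
  have pos: "0 < ip v (\<chi> j. of_int (v $ j))" by (rule ip_self_pos[OF False])
  define a where "a = to_torus ((1 / (2 * ip v (\<chi> j. of_int (v $ j)))) *\<^sub>R (\<chi> j. of_int (v $ j)))"
  have a: "chr v a = -1"
    using pos by (simp add: a_def chr_to_torus ip_scale_right del: vec_lambda_beta)
  have "?I = (\<integral>t. chr v t \<partial>distr torus_haar borel ((+) a))"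
    by (simp add: torus_haar_translation)
  also have "\<dots> = (\<integral>t. chr v (a + t) \<partial>torus_haar)"
    by (rule integral_distr) auto
  also have "\<dots> = - ?I" by (simp add: chr_add a)
  finally show ?thesis using False by simp
qed (simp add: measure_haar_UNIV)

text \<open>The linear span of the characters, generated inductively so that a property is checked
  on characters and passed through scalars and sums.\<close>

inductive trigp :: "('n::finite torus \<Rightarrow> complex) \<Rightarrow> bool" where
  trigp_chr: "trigp (chr v)"
| trigp_scale: "trigp f \<Longrightarrow> trigp (\<lambda>t. c * f t)"
| trigp_add: "trigp f \<Longrightarrow> trigp g \<Longrightarrow> trigp (\<lambda>t. f t + g t)"

lemma trigp_const: "trigp (\<lambda>t. c)"
  using trigp_scale[OF trigp_chr[of 0], of c] by simp

lemma trigp_chr_mult: "trigp g \<Longrightarrow> trigp (\<lambda>t. chr v t * g t)"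
proof (induction rule: trigp.induct)
  case (trigp_chr w)
  then show ?case using trigp.trigp_chr[of "v + w"] by (simp add: chr_add_index[abs_def])
next
  case (trigp_scale f c)
  then show ?case using trigp.trigp_scale[OF trigp_scale.IH, of c] by (simp add: algebra_simps)
next
  case (trigp_add f g)
  then show ?case using trigp.trigp_add[OF trigp_add.IH] by (simp add: algebra_simps)
qed

lemma trigp_mult: "trigp f \<Longrightarrow> trigp g \<Longrightarrow> trigp (\<lambda>t. f t * g t)"
proof (induction rule: trigp.induct)
  case (trigp_chr v)
  then show ?case by (rule trigp_chr_mult)
next
  case (trigp_scale f c)
  then show ?case using trigp.trigp_scale[of "\<lambda>t. f t * g t" c] by (simp add: algebra_simps)
next
  case (trigp_add f f')
  then show ?case
    using trigp.trigp_add[of "\<lambda>t. f t * g t" "\<lambda>t. f' t * g t"] by (simp add: algebra_simps)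
qed

lemma trigp_measurable [measurable_dest]: "trigp f \<Longrightarrow> f \<in> borel_measurable borel"
  by (induction rule: trigp.induct) auto

lemma trigp_bounded: "trigp f \<Longrightarrow> \<exists>B. \<forall>t. norm (f t) \<le> B"
proof (induction rule: trigp.induct)
  case (trigp_chr v)
  then show ?case by (auto intro: exI[of _ 1])
next
  case (trigp_scale f c)
  then obtain B where "\<forall>t. norm (f t) \<le> B" by blast
  then have "\<forall>t. norm (c * f t) \<le> norm c * B"
    by (auto simp: norm_mult intro: mult_left_mono)
  then show ?case by blast
next
  case (trigp_add f g)
  then obtain B C where "\<forall>t. norm (f t) \<le> B" "\<forall>t. norm (g t) \<le> C" by blast
  then have "\<forall>t. norm (f t + g t) \<le> B + C" by (meson add_mono norm_triangle_le)
  then show ?case by blast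
qed

lemma trigp_integrable: "trigp f \<Longrightarrow> integrable torus_haar f"
  using trigp_bounded[of f] integrable_haar_bounded[of f] trigp_measurable[of f] by blast

section \<open>Approximation of Borel sets by trigonometric polynomials\<close>

definition emb :: "'n::finite torus \<Rightarrow> complex ^ 'n" where
  "emb t = (\<chi> j. chr (axis j 1) t)"

lemma borel_measurable_vec:
  fixes f :: "'a \<Rightarrow> 'b::euclidean_space ^ 'n::finite"
  assumes "\<And>i. (\<lambda>x. f x $ i) \<in> borel_measurable M"
  shows "f \<in> borel_measurable M"
  unfolding borel_measurable_euclidean_space[of f]
  using assms by (auto simp: Basis_vec_def inner_axis)

lemma measurable_emb [measurable]: "emb \<in> borel_measurable borel"
  unfolding emb_def by (rule borel_measurable_vec) simp

text \<open>A Borel left inverse of \<open>emb\<close>, discontinuous at the branch cut of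
  \<open>Ln\<close>. It exhibits every Borel set of the torus as the preimage under
  \<open>emb\<close> of a Borel set of a Euclidean space.\<close>

definition unemb :: "complex ^ 'n::finite \<Rightarrow> 'n torus" where
  "unemb z = to_torus (\<chi> j. Im (Ln (z $ j)) / (2 * pi))"

lemma measurable_unemb [measurable]: "unemb \<in> borel_measurable borel"
proof -
  have [measurable]: "(\<lambda>z :: complex ^ 'n. z $ i) \<in> borel_measurable borel" for i
    by (intro borel_measurable_continuous_onI continuous_intros)
  have "(\<lambda>z :: complex ^ 'n. (\<chi> j. Im (Ln (z $ j)) / (2 * pi)) :: real ^ 'n) \<in> borel_measurable borel"
    by (rule borel_measurable_vec) simp
  from measurable_compose[OF this measurable_to_torus] show ?thesis
    by (simp add: unemb_def[abs_def])
qed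

lemma unemb_emb: "unemb (emb t) = t"
proof -
  obtain x where t: "t = to_torus x" by (rule torus_cases)
  have "Im (Ln (cis (2 * pi * x $ i))) / (2 * pi) - x $ i \<in> \<int>" for i
  proof -
    have "exp (Ln (cis (2 * pi * x $ i))) = exp (\<i> * of_real (2 * pi * x $ i))"
      by (simp add: cis_conv_exp)
    then obtain n :: int where
      "Ln (cis (2 * pi * x $ i)) = \<i> * of_real (2 * pi * x $ i) + (of_int (2 * n) * pi) * \<i>"
      unfolding exp_eq by blast
    then have "Im (Ln (cis (2 * pi * x $ i))) = 2 * pi * x $ i + 2 * n * pi" by simp
    then have "Im (Ln (cis (2 * pi * x $ i))) / (2 * pi) - x $ i = n"
      by (simp add: field_simps)
    then show ?thesis by simp
  qed
  then show ?thesis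
    by (simp add: t unemb_def emb_def chr_to_torus ip_axis_left to_torus_eq_iff torus_rel_def)
qed

lemma norm_emb_component: "norm (emb t $ j) = 1"
  by (simp add: emb_def)

text \<open>A real linear form is a combination of terms \<open>Re (c * z $ j)\<close>, and on the
  image of the torus each of these is half the sum of a multiple of a coordinate character and its
  conjugate, again a multiple of a character.\<close>

lemma trigp_polynomial:
  fixes p :: "complex ^ 'n::finite \<Rightarrow> real"
  assumes "real_polynomial_function p"
  shows "trigp (\<lambda>t. complex_of_real (p (emb t)))"
  using assms
proof (induction rule: real_polynomial_function.induct)
  case (linear f)
  have R: "trigp (\<lambda>t. complex_of_real (Re (c * emb t $ j)))" for c and j :: 'n
  proof -
    have "trigp (\<lambda>t. c / 2 * chr (axis j 1) t + cnj c / 2 * chr (- axis j 1) t)"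
      by (intro trigp.intros)
    moreover have "complex_of_real (Re (c * emb t $ j)) =
        c / 2 * chr (axis j 1) t + cnj c / 2 * chr (- axis j 1) t" for t
      by (simp add: emb_def chr_uminus complex_eq_iff flip: add_divide_distrib)
    ultimately show ?thesis by simp
  qed
  have S: "trigp (\<lambda>t. \<Sum>b\<in>B. h b t)" if "finite B" "\<And>b. b \<in> B \<Longrightarrow> trigp (h b)" for B and h :: "complex ^ 'n \<Rightarrow> 'n torus \<Rightarrow> complex"
    using that by (induction rule: finite_induct) (auto intro: trigp.intros trigp_const)
  have B: "trigp (\<lambda>t. complex_of_real (emb t \<bullet> b))" if bB: "b \<in> Basis" for b :: "complex ^ 'n"
  proof -
    obtain j and u :: complex where b: "b = axis j u" using bB unfolding Basis_vec_def by blast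
    show ?thesis using R[of "cnj u" j] by (simp add: b inner_axis inner_complex_def mult.commute)
  qed
  have "f x = (\<Sum>b\<in>Basis. f b * (x \<bullet> b))" for x
  proof -
    interpret bounded_linear f by fact
    have "f x = f (\<Sum>b\<in>Basis. (x \<bullet> b) *\<^sub>R b)" by (simp add: euclidean_representation)
    then show ?thesis by (simp add: sum scaleR mult.commute)
  qed
  then have *: "complex_of_real (f (emb t)) =
      (\<Sum>b\<in>Basis. of_real (f b) * complex_of_real (emb t \<bullet> b))" for t
    by (metis (no_types, lifting) of_real_mult of_real_sum sum.cong)
  show ?case
    unfolding * by (intro S trigp_scale B) auto
next
  case (mult f g)
  then show ?case by (simp add: trigp_mult)
qed (auto intro: trigp_const trigp_add)

lemma (in prob_space) integral_le_add_indicator: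
  fixes f :: "'a \<Rightarrow> real"
  assumes f: "f \<in> borel_measurable M" and D: "D \<in> sets M"
    and le: "\<And>x. x \<in> space M \<Longrightarrow> 0 \<le> f x \<and> f x \<le> e + c * indicator D x"
    and c: "0 \<le> c"
  shows "integrable M f" "(\<integral>x. f x \<partial>M) \<le> e + c * measure M D"
proof -
  have i: "integrable M (\<lambda>x. e + c * indicator D x)"
    using D by (intro Bochner_Integration.integrable_add) (auto simp: emeasure_eq_measure)
  show f: "integrable M f"
    by (rule Bochner_Integration.integrable_bound[OF i f]) (use le in \<open>force intro!: AE_I2\<close>)
  have "(\<integral>x. f x \<partial>M) \<le> (\<integral>x. e + c * indicator D x \<partial>M)"
    using le by (intro integral_mono f i) auto
  also have "\<dots> = e + c * measure M D"
    using D by (subst Bochner_Integration.integral_add) (auto simp: emeasure_eq_measure prob_space)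
  finally show "(\<integral>x. f x \<partial>M) \<le> e + c * measure M D" .
qed

text \<open>The embedding gives access to regularity, Urysohn functions and polynomial approximation
  in Euclidean space. The pushed-forward set lies between a compact \<open>K\<close> and an open
  \<open>U\<close> of nearly equal measure; a continuous function equal to 1 on \<open>K\<close> and
  0 off \<open>U\<close> is replaced by a polynomial, and the error exceeds \<open>d\<close> only on
  \<open>U - K\<close>. The uniform bound 2 is needed later, when products are approximated.\<close>

lemma approximate_indicator:
  fixes A :: "'n::finite torus set"
  assumes A: "A \<in> sets borel" and e: "0 < e"
  obtains P where "trigp P" "\<And>t. norm (P t) \<le> 2"
    "(\<integral>t. norm (indicator A t - P t) \<partial>torus_haar) < e"
proof -
  define S where "S = unemb -` A"
  have S: "S \<in> sets (borel :: (complex ^ 'n) measure)"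
    unfolding S_def using measurable_sets[OF measurable_unemb A] by simp
  have AS: "t \<in> A \<longleftrightarrow> emb t \<in> S" for t by (simp add: S_def unemb_emb)
  define \<nu> where "\<nu> = distr torus_haar borel (emb :: 'n torus \<Rightarrow> _)"
  have emb_m: "emb \<in> measurable torus_haar borel" by simp
  interpret \<nu>: prob_space \<nu>
    unfolding \<nu>_def by (rule haar.prob_space_distr[OF emb_m])
  have sets\<nu>: "sets \<nu> = sets borel" by (simp add: \<nu>_def)
  have fin: "emeasure \<nu> (space \<nu>) \<noteq> \<infinity>" by simp
  \<comment> \<open>The uniform error \<open>d\<close> and the measure of \<open>U - K\<close>,
    below \<open>2 * d\<close>, add up to less than \<open>4 * d\<close>. The minimum with 1 keeps
    the polynomial below 2 on the torus.\<close>
  define d where "d = min e 1 / 4"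
  have d: "0 < d" "d \<le> 1/4" "4 * d \<le> e" using e by (auto simp: d_def)
  have "\<exists>K. K \<subseteq> S \<and> compact K \<and> emeasure \<nu> S < emeasure \<nu> K + ennreal d"
  proof (cases "measure \<nu> S < d")
    case True
    then show ?thesis
      by (intro exI[of _ "{}"]) (simp add: \<nu>.emeasure_eq_measure ennreal_less_iff)
  next
    case False
    then have "ennreal (measure \<nu> S - d) < emeasure \<nu> S"
      using d by (simp add: \<nu>.emeasure_eq_measure ennreal_less_iff)
    then obtain K where "K \<subseteq> S" "compact K" "ennreal (measure \<nu> S - d) < emeasure \<nu> K"
      unfolding inner_regular[OF sets\<nu> fin S] less_SUP_iff by blast
    then show ?thesis
      using False d
      by (intro exI[of _ K])
        (auto simp: \<nu>.emeasure_eq_measure ennreal_less_iff simp flip: ennreal_plus)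
  qed
  then obtain K where K: "K \<subseteq> S" "compact K" "emeasure \<nu> S < emeasure \<nu> K + ennreal d" by blast
  have "emeasure \<nu> S < emeasure \<nu> S + ennreal d"
    using d by (simp add: \<nu>.emeasure_eq_measure ennreal_less_iff flip: ennreal_plus)
  then have "\<exists>U. S \<subseteq> U \<and> open U \<and> emeasure \<nu> U < emeasure \<nu> S + ennreal d"
    by (subst (asm) outer_regular[OF sets\<nu> fin S]) (auto simp: INF_less_iff)
  then obtain U where U: "S \<subseteq> U" "open U" "emeasure \<nu> U < emeasure \<nu> S + ennreal d" by blast
  have Km: "K \<in> sets \<nu>" and Um: "U \<in> sets \<nu>" and Sm: "S \<in> sets \<nu>"
    using K U S by (auto simp: sets\<nu> compact_imp_closed)
  have "measure \<nu> (U - K) = measure \<nu> U - measure \<nu> K"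
    using K(1) U(1) Km Um by (intro \<nu>.finite_measure_Diff) auto
  moreover have "measure \<nu> U < measure \<nu> S + d" "measure \<nu> S < measure \<nu> K + d"
    using K(3) U(3) d by (simp_all add: \<nu>.emeasure_eq_measure ennreal_less_iff flip: ennreal_plus)
  ultimately have D: "measure \<nu> (U - K) < 2 * d" by simp
  obtain f :: "complex ^ 'n \<Rightarrow> real" where f: "continuous_on UNIV f"
    "\<And>x. f x \<in> closed_segment 0 1" "\<And>x. x \<in> - U \<Longrightarrow> f x = 0" "\<And>x. x \<in> K \<Longrightarrow> f x = 1"
    by (rule Urysohn[of "- U" K 0 1]) (use K U in \<open>auto simp: compact_imp_closed\<close>)
  define T where "T = cball (0 :: complex ^ 'n) (real CARD('n))"
  have embT: "emb t \<in> T" for t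
  proof -
    have "norm (emb t) \<le> (\<Sum>i\<in>UNIV. norm (emb t $ i))" unfolding norm_vec_def by (rule L2_set_le_sum) simp
    then show ?thesis by (simp add: T_def norm_emb_component)
  qed
  have "compact T" "continuous_on T f"
    using f(1) by (auto simp: T_def intro: continuous_on_subset)
  from Stone_Weierstrass_real_polynomial_function[OF this d(1)]
  obtain p where p: "real_polynomial_function p" "\<And>x. x \<in> T \<Longrightarrow> \<bar>f x - p x\<bar> < d" by auto
  define P where "P t = complex_of_real (p (emb t))" for t
  have P: "trigp P" unfolding P_def by (rule trigp_polynomial[OF p(1)])
  have f01: "0 \<le> f x" "f x \<le> 1" for x
    using f(2)[of x] by (auto simp: closed_segment_eq_real_ivl)
  have bound: "norm (indicator A t - P t) \<le> d + 1 * indicator (emb -` (U - K)) t" for t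
  proof -
    have "norm (indicator A t - P t) = \<bar>indicator S (emb t) - p (emb t)\<bar>"
      unfolding P_def by (subst norm_of_real[where 'a = complex, symmetric]) (simp add: indicator_def AS)
    also have "\<dots> \<le> \<bar>indicator S (emb t) - f (emb t)\<bar> + \<bar>f (emb t) - p (emb t)\<bar>" by simp
    also have "\<bar>f (emb t) - p (emb t)\<bar> \<le> d" using p(2)[OF embT] by (rule less_imp_le)
    also have "\<bar>indicator S (emb t) - f (emb t)\<bar> \<le> indicator (U - K) (emb t)"
      using f(3,4)[of "emb t"] f01[of "emb t"] K(1) U(1) by (auto simp: indicator_def)
    finally show ?thesis by (simp add: indicator_def)
  qed
  show thesis
  proof
    show "trigp P" by fact
    show "norm (P t) \<le> 2" for t
      using p(2)[OF embT, of t] f01[of "emb t"] d by (simp add: P_def)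
    have [measurable]: "P \<in> borel_measurable borel" by (rule trigp_measurable[OF P])
    have "U - K \<in> sets borel" using Um Km sets\<nu> by auto
    then have m: "emb -` (U - K) \<in> sets torus_haar"
      using measurable_sets[OF emb_m] by simp
    have "(\<integral>t. norm (indicator A t - P t) \<partial>torus_haar) \<le>
        d + 1 * measure torus_haar (emb -` (U - K))"
      by (rule haar.integral_le_add_indicator(2)[OF _ m]) (use bound A in auto)
    also have "measure torus_haar (emb -` (U - K)) = measure \<nu> (U - K)"
      unfolding \<nu>_def by (subst measure_distr[OF emb_m]) (use \<open>U - K \<in> sets borel\<close> in auto)
    finally show "(\<integral>t. norm (indicator A t - P t) \<partial>torus_haar) < e" using D d by simp
  qed
qed

subsection \<open>Duals of lattice endomorphisms\<close>

definition zadditive :: "(int ^ 'n::finite \<Rightarrow> int ^ 'n) \<Rightarrow> bool" where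
  "zadditive f \<longleftrightarrow> (\<forall>v w. f (v + w) = f v + f w)"

lemma zadditive_zero: "zadditive f \<Longrightarrow> f 0 = 0"
  unfolding zadditive_def by (metis add_cancel_left_left)

lemma zadditive_minus: "zadditive f \<Longrightarrow> f (- v) = - f v"
  using zadditive_zero[of f] unfolding zadditive_def
  by (metis eq_neg_iff_add_eq_0)

lemma zadditive_scale_nat: "zadditive f \<Longrightarrow> f (int k *s v) = int k *s f v"
proof (induction k)
  case 0
  then show ?case by (simp add: zadditive_zero)
next
  case (Suc k)
  have "int (Suc k) *s v = v + int k *s v" "int (Suc k) *s f v = f v + int k *s f v"
    by (simp_all add: vec_eq_iff algebra_simps)
  with Suc show ?case by (simp add: zadditive_def)
qed

lemma zadditive_scale: "zadditive f \<Longrightarrow> f (k *s v) = k *s f v"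
proof (cases "0 \<le> k")
  case True
  assume "zadditive f"
  from zadditive_scale_nat[OF this, of "nat k" v] True show ?thesis by simp
next
  case False
  assume f: "zadditive f"
  have "k *s v = - (int (nat (- k)) *s v)" "k *s f v = - (int (nat (- k)) *s f v)"
    using False by (simp_all add: vec_eq_iff)
  then show ?thesis
    by (simp only: zadditive_minus[OF f] zadditive_scale_nat[OF f])
qed

lemma zadditive_expand:
  assumes f: "zadditive f"
  shows "f v = (\<Sum>i\<in>UNIV. v $ i *s f (axis i 1))"
proof -
  have S: "f (sum g I) = (\<Sum>i\<in>I. f (g i))" if "finite I" for g :: "'a \<Rightarrow> _" and I
    using that f by (induction rule: finite_induct) (auto simp: zadditive_zero zadditive_def)
  have "f v = f (\<Sum>i\<in>UNIV. v $ i *s axis i 1)"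
    by (simp only: basis_expansion)
  then show ?thesis by (simp add: S zadditive_scale[OF f])
qed

text \<open>The transpose of the integer matrix of \<open>f\<close>, which is why composition is
  reversed when passing from characters to the torus.\<close>

definition dual_lin :: "(int ^ 'n::finite \<Rightarrow> int ^ 'n) \<Rightarrow> real ^ 'n \<Rightarrow> real ^ 'n" where
  "dual_lin f x = (\<chi> i. ip (f (axis i 1)) x)"

lemma ip_dual_lin:
  assumes "zadditive f"
  shows "ip v (dual_lin f x) = ip (f v) x"
proof -
  have "ip (f v) x = (\<Sum>j\<in>UNIV. of_int (\<Sum>i\<in>UNIV. v $ i * f (axis i 1) $ j) * x $ j)"
    by (subst zadditive_expand[OF assms]) (simp add: ip_def)
  also have "\<dots> = (\<Sum>i\<in>UNIV. of_int (v $ i) * ip (f (axis i 1)) x)"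
    unfolding ip_def sum_distrib_left of_int_sum sum_distrib_right
    by (subst sum.swap) (simp add: mult.assoc)
  finally show ?thesis by (simp add: ip_def[of v] dual_lin_def)
qed

lemma dual_lin_add: "dual_lin f (x + y) = dual_lin f x + dual_lin f y"
  by (simp add: dual_lin_def ip_add_right vec_eq_iff)

lift_definition dual_map :: "(int ^ 'n::finite \<Rightarrow> int ^ 'n) \<Rightarrow> 'n torus \<Rightarrow> 'n torus" is dual_lin
  unfolding torus_rel_def
  by (auto simp: dual_lin_def simp flip: ip_diff_right intro!: ip_Ints)

lemma dual_map_to_torus: "dual_map f (to_torus x) = to_torus (dual_lin f x)"
  by (rule dual_map.abs_eq)

lemma chr_dual_map: "zadditive f \<Longrightarrow> chr v (dual_map f t) = chr (f v) t"
  by transfer (simp add: ip_dual_lin)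

lemma chr_injective: "chr v = chr w \<Longrightarrow> v = w"
proof (rule ccontr)
  assume e: "chr v = chr w" and "v \<noteq> w"
  then have "(\<integral>t. chr (v - w) t \<partial>torus_haar) = 0" by (simp add: integral_chr)
  moreover have "chr (v - w) t = 1" for t
  proof -
    have "chr (v - w) t = chr w t * cnj (chr w t)"
      using chr_add_index[of v "- w" t] e by (simp add: chr_uminus)
    also have "\<dots> = 1" by (metis complex_norm_square mult_1 norm_chr of_real_1 power_one)
    finally show ?thesis .
  qed
  ultimately show False by (simp add: measure_haar_UNIV)
qed

lemma dual_map_injective:
  assumes "zadditive f" "zadditive g" "dual_map f = dual_map g"
  shows "f = g"
proof
  fix v
  have "chr (f v) = chr (g v)"
    using assms(3) by (auto simp: fun_eq_iff chr_dual_map[symmetric] assms(1,2))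
  then show "f v = g v" by (rule chr_injective)
qed

lemma torus_eqI_chr: "(\<And>v. chr v s = chr v t) \<Longrightarrow> s = t"
  by (metis emb_def unemb_emb vec_lambda_unique)

lemma dual_map_comp:
  assumes "zadditive f" "zadditive g"
  shows "dual_map f \<circ> dual_map g = dual_map (g \<circ> f)"
proof
  fix t
  have "zadditive (g \<circ> f)" using assms by (simp add: zadditive_def)
  then show "(dual_map f \<circ> dual_map g) t = dual_map (g \<circ> f) t"
    by (intro torus_eqI_chr) (simp add: chr_dual_map assms)
qed

lemma dual_map_id: "dual_map id = id"
  by (rule ext, rule torus_eqI_chr) (simp add: chr_dual_map zadditive_def)

lemma dual_map_add: "dual_map f (s + t) = dual_map f s + dual_map f t"
  by transfer (simp add: dual_lin_add torus_rel_def)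

lemma continuous_dual_lin: "continuous_on UNIV (dual_lin f)"
  unfolding dual_lin_def by (intro continuous_intros)

lemma continuous_dual_map: "continuous_on UNIV (dual_map f)"
proof (rule continuous_on_torusI, unfold dual_map_to_torus)
  show "continuous_on UNIV (\<lambda>x. to_torus (dual_lin f x))"
    using continuous_on_compose2[OF continuous_to_torus continuous_dual_lin] by simp
qed

lemma measurable_dual_map [measurable]: "dual_map f \<in> borel_measurable borel"
  by (rule borel_measurable_continuous_onI[OF continuous_dual_map])

lemma dual_map_in_Aut:
  assumes "zadditive f" "zadditive g" "f \<circ> g = id" "g \<circ> f = id"
  shows "dual_map f \<in> carrier torus_Aut"
proof -
  have "dual_map f \<circ> dual_map g = id" "dual_map g \<circ> dual_map f = id"
    by (simp_all add: dual_map_comp assms dual_map_id)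
  then have "homeomorphism UNIV UNIV (dual_map f) (dual_map g)"
    unfolding homeomorphism_def fun_eq_iff
    by (auto simp: continuous_dual_map intro!: surjI)
  then show ?thesis by (auto simp: torus_Aut_def dual_map_add)
qed

section \<open>Invariance of Haar measure under automorphisms, and its positivity on open
  sets\<close>

lemma nn_integral_haar:
  assumes [measurable]: "f \<in> borel_measurable borel"
  shows "(\<integral>\<^sup>+t. f t \<partial>(torus_haar :: 'n::finite torus measure)) =
    (\<integral>\<^sup>+x. f (to_torus x) * indicator unit_cube x \<partial>lborel)"
  unfolding torus_haar_def
  by (subst nn_integral_distr)
    (auto simp: nn_integral_restrict_space measurable_restrict_space1 intro!: measurable_restrict_space1)

lemma nn_integral_haar_shift:
  assumes [measurable]: "f \<in> borel_measurable borel"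
  shows "(\<integral>\<^sup>+t. f (a + t) \<partial>torus_haar) = (\<integral>\<^sup>+t. f t \<partial>torus_haar)"
proof -
  have "(\<integral>\<^sup>+t. f t \<partial>torus_haar) = (\<integral>\<^sup>+t. f t \<partial>distr torus_haar borel ((+) a))"
    by (simp add: torus_haar_translation)
  also have "\<dots> = (\<integral>\<^sup>+t. f (a + t) \<partial>torus_haar)"
    by (rule nn_integral_distr) auto
  finally show ?thesis ..
qed

text \<open>The integral of the indicator of \<open>A\<close> at \<open>x + dual_lin f z\<close>,
  over \<open>x\<close> and \<open>z\<close> in the cube, is evaluated in both orders. Inner
  integration over \<open>x\<close> gives the measure of \<open>A\<close> by translation invariance.
  For fixed \<open>x\<close>, surjectivity writes the class of \<open>x\<close> as the image of some
  \<open>b\<close>, and inner integration over \<open>z\<close> gives the measure of the preimage.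
  No determinant enters.\<close>

lemma emeasure_haar_dual_map:
  fixes A :: "'n::finite torus set"
  assumes f: "zadditive f" and g: "zadditive g" and fg: "f \<circ> g = id" "g \<circ> f = id"
    and A [measurable]: "A \<in> sets borel"
  shows "emeasure torus_haar (dual_map f -` A) = emeasure torus_haar A"
proof -
  have inv: "dual_map f (dual_map g t) = t" for t
    using dual_map_comp[OF f g] fg by (simp add: dual_map_id fun_eq_iff)
  have [measurable]: "dual_lin f \<in> borel_measurable borel"
    by (rule borel_measurable_continuous_onI[OF continuous_dual_lin])
  let ?F = "\<lambda>x z. indicator A (to_torus (x + dual_lin f z)) :: ennreal"
  let ?C = "indicator unit_cube :: real ^ 'n \<Rightarrow> ennreal"
  have [measurable]: "dual_map f -` A \<in> sets borel"
    using measurable_sets[OF measurable_dual_map A] by simp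
  have one: "(\<integral>\<^sup>+x. ?C x \<partial>lborel) = 1"
    by (simp add: emeasure_unit_cube)
  have [measurable]: "(\<lambda>t. t + c) \<in> borel_measurable borel" for c :: "'n torus"
    using measurable_torus_shift[of c] by (simp add: add.commute[of _ c])
  have inner1: "(\<integral>\<^sup>+x. ?F x z * ?C x \<partial>lborel) = emeasure torus_haar A" for z
  proof -
    have "(\<integral>\<^sup>+x. ?F x z * ?C x \<partial>lborel) =
        (\<integral>\<^sup>+t. indicator A (to_torus (dual_lin f z) + t) \<partial>torus_haar)"
      by (subst nn_integral_haar) (simp_all add: to_torus_add[symmetric] add.commute)
    also have "\<dots> = (\<integral>\<^sup>+t. indicator A t \<partial>torus_haar)"
      by (rule nn_integral_haar_shift) auto
    finally show ?thesis by simp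
  qed
  have inner2: "(\<integral>\<^sup>+z. ?F x z * ?C z \<partial>lborel) = emeasure torus_haar (dual_map f -` A)" for x
  proof -
    define b where "b = dual_map g (to_torus x)"
    have b: "dual_map f b = to_torus x" by (simp add: b_def inv)
    have "(\<integral>\<^sup>+z. ?F x z * ?C z \<partial>lborel) =
        (\<integral>\<^sup>+t. indicator (dual_map f -` A) (b + t) \<partial>torus_haar)"
      by (subst nn_integral_haar)
        (simp_all add: indicator_def dual_map_add b dual_map_to_torus to_torus_add)
    also have "\<dots> = (\<integral>\<^sup>+t. indicator (dual_map f -` A) t \<partial>torus_haar)"
      by (rule nn_integral_haar_shift) auto
    finally show ?thesis by simp
  qed
  have "emeasure torus_haar A = (\<integral>\<^sup>+z. (\<integral>\<^sup>+x. ?F x z * ?C x \<partial>lborel) * ?C z \<partial>lborel)"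
    by (simp add: inner1 nn_integral_cmult one)
  also have "\<dots> = (\<integral>\<^sup>+z. (\<integral>\<^sup>+x. ?F x z * ?C x * ?C z \<partial>lborel) \<partial>lborel)"
    by (intro nn_integral_cong nn_integral_multc[symmetric]) measurable
  also have "\<dots> = (\<integral>\<^sup>+x. (\<integral>\<^sup>+z. ?F x z * ?C x * ?C z \<partial>lborel) \<partial>lborel)"
    by (rule lborel_pair.Fubini') measurable
  also have "\<dots> = (\<integral>\<^sup>+x. (\<integral>\<^sup>+z. ?F x z * ?C z \<partial>lborel) * ?C x \<partial>lborel)"
    by (intro nn_integral_cong, subst nn_integral_multc[symmetric]) (auto simp: ac_simps)
  also have "\<dots> = emeasure torus_haar (dual_map f -` A)"
    by (simp add: inner2 nn_integral_cmult one)
  finally show ?thesis ..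
qed


text \<open>A representative in the half-open cube may lie on its boundary, but it lies in the
  closure of the open box, so the open preimage of \<open>U\<close> meets that box in a nonempty
  open set.\<close>

lemma haar_open_pos:
  fixes U :: "'n::finite torus set"
  assumes "open U" "U \<noteq> {}"
  shows "0 < measure torus_haar U"
proof -
  let ?V = "to_torus -` U"
  let ?b = "(\<chi> i. 1) :: real ^ 'n"
  have V: "open ?V" using assms by (simp add: open_torus_def)
  obtain u where u: "u \<in> U" using assms(2) by blast
  obtain x where "u = to_torus x" by (rule torus_cases)
  then have x: "to_torus x \<in> U" using u by simp
  define y where "y = (\<chi> i. x $ i - real_of_int \<lfloor>x $ i\<rfloor>)"
  have "to_torus y = to_torus x" by (simp add: to_torus_eq_iff torus_rel_def y_def)
  then have yV: "y \<in> ?V" using x by simp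
  have ne: "(1 / 2) *\<^sub>R ?b \<in> box 0 ?b" by (simp add: mem_box_cart)
  have "0 \<le> y $ i \<and> y $ i \<le> 1" for i
    using frac_ge_0[of "x $ i"] frac_lt_1[of "x $ i"] by (simp add: y_def frac_def)
  then have "y \<in> cbox 0 ?b"
    by (simp add: mem_box_cart)
  then have "y \<in> closure (box 0 ?b)" using ne by (subst closure_box) auto
  then have "?V \<inter> box 0 ?b \<noteq> {}"
    using V yV by (metis Int_iff open_Int_closure_eq_empty empty_iff)
  moreover have "open (?V \<inter> box 0 ?b)" using V by auto
  ultimately have "\<not> ?V \<inter> box 0 ?b \<in> null_sets lborel"
    using open_not_negligible negligible_iff_null_sets null_sets_completionI by blast
  then have "0 < emeasure lborel (?V \<inter> box 0 ?b)"
    using V by (auto simp: null_sets_def zero_less_iff_neq_zero)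
  also have "\<dots> \<le> emeasure lborel (unit_cube \<inter> ?V)"
    using V by (intro emeasure_mono) (auto simp: unit_cube_def mem_box_cart less_imp_le)
  also have "\<dots> = emeasure torus_haar U"
    using assms by (simp add: emeasure_torus_haar)
  finally show ?thesis by (simp add: haar.emeasure_eq_measure)
qed

lemma trigp_dual_map: "trigp Q \<Longrightarrow> zadditive f \<Longrightarrow> trigp (\<lambda>t. Q (dual_map f t))"
  by (induction rule: trigp.induct)
    (auto simp: chr_dual_map intro: trigp.intros)

text \<open>Two powers of \<open>x\<close> lie in the same coset, and their quotient is the required
  power.\<close>

lemma subgroup_finite_index_power:
  fixes G (structure)
  assumes "group G" "subgroup H G" "finite (rcosets H)" "x \<in> carrier G"
  obtains n :: nat where "1 \<le> n" "x [^] n \<in> H"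
proof -
  interpret group G by fact
  interpret H: subgroup H G by fact
  have "range (\<lambda>n :: nat. H #> x [^] n) \<subseteq> rcosets H"
    using assms(4) H.subset by (auto simp: rcosetsI)
  then have "\<not> inj (\<lambda>n :: nat. H #> x [^] n)"
    using assms(3) finite_subset range_inj_infinite by blast
  then obtain i j :: nat where ij: "i < j" "H #> x [^] i = H #> x [^] j"
    unfolding inj_def by (metis linorder_neqE_nat)
  have "x [^] j \<in> H #> x [^] i"
    using rcos_self[OF _ assms(2), of "x [^] j"] assms(4) ij by simp
  then obtain h where h: "h \<in> H" "x [^] j = h \<otimes> x [^] i"
    by (auto simp: r_coset_def)
  have "x [^] (j - i) \<otimes> x [^] i = h \<otimes> x [^] i"
    using ij(1) assms(4) h(2) by (simp add: nat_pow_mult)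
  then have "x [^] (j - i) = h"
    using assms(4) h(1) H.mem_carrier by (metis nat_pow_closed right_cancel)
  then show thesis using h(1) ij(1) that[of "j - i"] by simp
qed

subsection \<open>Groups acting freely on the characters\<close>

locale dual_group =
  fixes G :: "(int ^ 'n::finite \<Rightarrow> int ^ 'n) set"
  assumes zadditive: "f \<in> G \<Longrightarrow> zadditive f"
    and id_mem: "id \<in> G"
    and comp_mem: "f \<in> G \<Longrightarrow> g \<in> G \<Longrightarrow> f \<circ> g \<in> G"
    and inverse_mem: "f \<in> G \<Longrightarrow> \<exists>g\<in>G. f \<circ> g = id \<and> g \<circ> f = id"
    and fixed_point_free: "f \<in> G \<Longrightarrow> f v = v \<Longrightarrow> v \<noteq> 0 \<Longrightarrow> f = id"
begin

definition \<Gamma> :: "('n torus \<Rightarrow> 'n torus) set" where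
  "\<Gamma> = dual_map ` G"

lemma subgroup_\<Gamma>: "subgroup \<Gamma> torus_Aut"
proof (rule group.subgroupI[OF group_torus_Aut])
  show sub: "\<Gamma> \<subseteq> carrier torus_Aut"
    unfolding \<Gamma>_def using inverse_mem zadditive dual_map_in_Aut by blast
  show "\<Gamma> \<noteq> {}" using id_mem by (auto simp: \<Gamma>_def)
  show "x \<otimes>\<^bsub>torus_Aut\<^esub> y \<in> \<Gamma>" if "x \<in> \<Gamma>" "y \<in> \<Gamma>" for x y
    using that by (auto simp: \<Gamma>_def torus_Aut_def dual_map_comp zadditive comp_mem)
  show "inv\<^bsub>torus_Aut\<^esub> x \<in> \<Gamma>" if x: "x \<in> \<Gamma>" for x
  proof -
    obtain f where f: "f \<in> G" "x = dual_map f" using x by (auto simp: \<Gamma>_def)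
    obtain g where g: "g \<in> G" "f \<circ> g = id" "g \<circ> f = id" using inverse_mem f by blast
    have "dual_map g \<otimes>\<^bsub>torus_Aut\<^esub> x = \<one>\<^bsub>torus_Aut\<^esub>"
      using f g by (simp add: torus_Aut_def dual_map_comp zadditive dual_map_id)
    moreover have g\<Gamma>: "dual_map g \<in> \<Gamma>" using g by (simp add: \<Gamma>_def)
    ultimately have "inv\<^bsub>torus_Aut\<^esub> x = dual_map g"
      using sub x by (intro group.inv_equality[OF group_torus_Aut]) auto
    then show ?thesis using g\<Gamma> by simp
  qed
qed

lemma finite_transporter:
  assumes "v \<noteq> 0"
  shows "finite {f \<in> G. f v = w}"
proof (cases "{f \<in> G. f v = w} = {}")
  case False
  then obtain g where g: "g \<in> G" "g v = w" by blast
  obtain h where h: "h \<in> G" "g \<circ> h = id" "h \<circ> g = id" using inverse_mem g by blast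
  have "f = g" if "f \<in> G" "f v = w" for f
  proof -
    have "(h \<circ> f) v = v" using that(2) g(2) h(3) by (metis comp_apply id_apply)
    then have "h \<circ> f = id" using fixed_point_free comp_mem that h assms by blast
    then have "(g \<circ> h) \<circ> f = g" by (simp add: comp_assoc)
    then show ?thesis using h by simp
  qed
  then have "{f \<in> G. f v = w} \<subseteq> {g}" by auto
  then show ?thesis by (rule finite_subset) simp
qed (simp only: finite.emptyI)

text \<open>On trigonometric polynomials mixing is an exact identity off a finite set, not merely a
  limit. For two characters with \<open>w \<noteq> 0\<close> it can fail only where
  \<open>f w = - v\<close>, which leaves finitely many \<open>f\<close> by freeness.\<close>

lemma trigp_decorrelate_chr:
  assumes "trigp Q"
  shows "finite {f \<in> G. (\<integral>t. chr v t * Q (dual_map f t) \<partial>torus_haar) \<noteq>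
    (\<integral>t. chr v t \<partial>torus_haar) * (\<integral>t. Q t \<partial>torus_haar)}"
  using assms
proof (induction rule: trigp.induct)
  case (trigp_chr w)
  have eq: "(\<integral>t. chr v t * chr w (dual_map f t) \<partial>torus_haar) = (if v + f w = 0 then 1 else 0)"
    if "f \<in> G" for f
    using that by (simp add: chr_dual_map zadditive integral_chr flip: chr_add_index)
  show ?case
  proof (cases "w = 0")
    case True
    then have "{f \<in> G. (\<integral>t. chr v t * chr w (dual_map f t) \<partial>torus_haar) \<noteq>
        (\<integral>t. chr v t \<partial>torus_haar) * (\<integral>t. chr w t \<partial>torus_haar)} = {}"
      using eq by (auto simp: integral_chr zadditive zadditive_zero measure_haar_UNIV)
    then show ?thesis by (simp only: finite.emptyI)
  next
    case False
    then have "{f \<in> G. (\<integral>t. chr v t * chr w (dual_map f t) \<partial>torus_haar) \<noteq>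
        (\<integral>t. chr v t \<partial>torus_haar) * (\<integral>t. chr w t \<partial>torus_haar)} \<subseteq> {f \<in> G. f w = - v}"
      using eq by (auto simp: integral_chr eq_neg_iff_add_eq_0 add.commute split: if_splits)
    then show ?thesis using finite_transporter[OF False] finite_subset by blast
  qed
next
  case (trigp_scale Q c)
  show ?case
    by (rule finite_subset[OF _ trigp_scale.IH]) (auto simp: mult.left_commute[of _ c])
next
  case (trigp_add Q R)
  note i = trigp_integrable[OF trigp_mult[OF trigp_chr trigp_dual_map]]
    and j = trigp_integrable
  show ?case
    by (rule finite_subset[OF _ finite_UnI[OF trigp_add.IH]])
      (auto simp: distrib_left i j trigp_add.hyps zadditive)
qed

lemma trigp_decorrelate:
  assumes "trigp P" "trigp Q"
  shows "finite {f \<in> G. (\<integral>t. P t * Q (dual_map f t) \<partial>torus_haar) \<noteq>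
    (\<integral>t. P t \<partial>torus_haar) * (\<integral>t. Q t \<partial>torus_haar)}"
  using assms
proof (induction rule: trigp.induct)
  case (trigp_chr v)
  then show ?case by (rule trigp_decorrelate_chr)
next
  case (trigp_scale P c)
  show ?case
    by (rule finite_subset[OF _ trigp_scale.IH[OF trigp_scale.prems]]) (auto simp: mult.assoc)
next
  case (trigp_add P R)
  note i = trigp_integrable[OF trigp_mult[OF _ trigp_dual_map]]
    and j = trigp_integrable
  show ?case
    by (rule finite_subset[OF _ finite_UnI[OF trigp_add.IH(1)[OF trigp_add.prems]
        trigp_add.IH(2)[OF trigp_add.prems]]])
      (auto simp: distrib_right i j trigp_add.hyps trigp_add.prems zadditive)
qed

lemma distr_dual_map: "f \<in> G \<Longrightarrow> distr torus_haar borel (dual_map f) = torus_haar"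
proof (rule measure_eqI)
  fix A assume f: "f \<in> G" and A: "A \<in> sets (distr torus_haar borel (dual_map f))"
  obtain g where g: "g \<in> G" "f \<circ> g = id" "g \<circ> f = id" using inverse_mem f by blast
  show "emeasure (distr torus_haar borel (dual_map f)) A = emeasure torus_haar A"
    using A emeasure_haar_dual_map[OF zadditive[OF f] zadditive[OF g(1)] g(2,3), of A]
    by (subst emeasure_distr) auto
qed simp

text \<open>With approximations within \<open>e / 6\<close> and bounded by 2, replacing
  \<open>A\<close> costs one unit and replacing \<open>B\<close> costs two, both in the correlation
  and in the product of the integrals: six units in all.\<close>

lemma mixing_estimate:
  fixes A B :: "'n torus set"
  assumes [measurable]: "A \<in> sets borel" "B \<in> sets borel" and e: "0 < e"
  shows "finite {f \<in> G. e \<le> \<bar>measure torus_haar (A \<inter> dual_map f -` B) -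
    measure torus_haar A * measure torus_haar B\<bar>}"
proof -
  have d: "0 < e / 6" using e by simp
  obtain P where P: "trigp P" "\<And>t. norm (P t) \<le> 2"
    "(\<integral>t. norm (indicator A t - P t) \<partial>torus_haar) < e / 6"
    using approximate_indicator[OF assms(1) d] by blast
  obtain Q where Q: "trigp Q" "\<And>t. norm (Q t) \<le> 2"
    "(\<integral>t. norm (indicator B t - Q t) \<partial>torus_haar) < e / 6"
    using approximate_indicator[OF assms(2) d] by blast
  note [measurable] = trigp_measurable[OF P(1)] trigp_measurable[OF Q(1)]
  have ind: "(\<integral>t. indicator S t \<partial>torus_haar) = complex_of_real (measure torus_haar S)"
    if "S \<in> sets borel" for S :: "'n torus set"
  proof -
    have "(\<integral>t. indicator S t \<partial>torus_haar) = (\<integral>t. complex_of_real (indicator S t) \<partial>torus_haar)"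
      by (intro Bochner_Integration.integral_cong) (auto simp: indicator_def)
    then show ?thesis using that by simp
  qed
  have indI: "integrable torus_haar (indicator S :: _ \<Rightarrow> complex)"
    if "S \<in> sets borel" for S :: "'n torus set"
    using that by (intro integrable_haar_bounded[where B = 1]) (auto simp: indicator_def)
  have IP: "norm ((\<integral>t. P t \<partial>torus_haar) - measure torus_haar A) \<le> e / 6"
  proof -
    have "norm ((\<integral>t. indicator A t - P t \<partial>torus_haar)) \<le> e / 6"
      using integral_norm_bound[of torus_haar "\<lambda>t. indicator A t - P t"] P(3) by linarith
    then show ?thesis
      using indI[OF assms(1)] trigp_integrable[OF P(1)] by (simp add: ind norm_minus_commute)
  qed
  have IQ: "norm ((\<integral>t. Q t \<partial>torus_haar) - measure torus_haar B) \<le> e / 6"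
  proof -
    have "norm ((\<integral>t. indicator B t - Q t \<partial>torus_haar)) \<le> e / 6"
      using integral_norm_bound[of torus_haar "\<lambda>t. indicator B t - Q t"] Q(3) by linarith
    then show ?thesis
      using indI[OF assms(2)] trigp_integrable[OF Q(1)] by (simp add: ind norm_minus_commute)
  qed
  have IP2: "norm (\<integral>t. P t \<partial>torus_haar) \<le> 2"
  proof -
    have "norm (\<integral>t. P t \<partial>torus_haar) \<le> (\<integral>t. norm (P t) \<partial>torus_haar)"
      by (rule integral_norm_bound)
    also have "\<dots> \<le> (\<integral>t. 2 \<partial>(torus_haar :: 'n torus measure))"
      using P(2) trigp_integrable[OF P(1)] by (intro integral_mono) auto
    finally show ?thesis by (simp add: measure_haar_UNIV)
  qed
  have prod: "norm ((\<integral>t. P t \<partial>torus_haar) * (\<integral>t. Q t \<partial>torus_haar) -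
      complex_of_real (measure torus_haar A * measure torus_haar B)) \<le> 3 * (e / 6)"
  proof -
    define p q a b where "p = (\<integral>t. P t \<partial>torus_haar)" "q = (\<integral>t. Q t \<partial>torus_haar)"
      "a = measure torus_haar A" "b = measure torus_haar B"
    have "p * q - complex_of_real (a * b) = p * (q - b) + (p - a) * b"
      by (simp add: algebra_simps)
    also have "norm \<dots> \<le> norm p * norm (q - b) + norm (p - a) * \<bar>b\<bar>"
      by (metis norm_mult norm_of_real norm_triangle_ineq)
    also have "\<dots> \<le> 2 * (e / 6) + (e / 6) * 1"
      using IP IQ IP2 e
      by (intro add_mono mult_mono) (auto simp: p_q_a_b_def)
    finally show ?thesis by (simp add: p_q_a_b_def)
  qed
  have main: "norm (complex_of_real (measure torus_haar (A \<inter> dual_map f -` B)) -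
      (\<integral>t. P t * Q (dual_map f t) \<partial>torus_haar)) < 3 * (e / 6)" if f: "f \<in> G" for f
  proof -
    have fB [measurable]: "dual_map f -` B \<in> sets borel"
      using measurable_sets[OF measurable_dual_map assms(2)] by simp
    have int1: "integrable torus_haar (\<lambda>t. norm (indicator A t - P t))"
      using indI[OF assms(1)] trigp_integrable[OF P(1)] by auto
    have int2: "integrable torus_haar (\<lambda>t. norm (indicator B (dual_map f t) - Q (dual_map f t)))"
    proof (rule integrable_haar_bounded[where B = 3])
      show "norm (norm (indicator B (dual_map f t) - Q (dual_map f t))) \<le> 3" for t
        using norm_triangle_ineq4[of "indicator B (dual_map f t) :: complex" "Q (dual_map f t)"]
          Q(2)[of "dual_map f t"] by (auto simp: indicator_def split: if_splits)
    qed measurable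
    have "complex_of_real (measure torus_haar (A \<inter> dual_map f -` B)) -
        (\<integral>t. P t * Q (dual_map f t) \<partial>torus_haar) =
        (\<integral>t. indicator (A \<inter> dual_map f -` B) t - P t * Q (dual_map f t) \<partial>torus_haar)"
      using indI[of "A \<inter> dual_map f -` B"]
        trigp_integrable[OF trigp_mult[OF P(1) trigp_dual_map[OF Q(1) zadditive[OF f]]]]
      by (simp add: ind)
    also have "norm \<dots> \<le> (\<integral>t. norm (indicator (A \<inter> dual_map f -` B) t - P t * Q (dual_map f t)) \<partial>torus_haar)"
      by (rule integral_norm_bound)
    also have "\<dots> \<le> (\<integral>t. norm (indicator A t - P t) +
        2 * norm (indicator B (dual_map f t) - Q (dual_map f t)) \<partial>torus_haar)"
    proof (rule integral_mono)
      show "integrable torus_haar (\<lambda>t. norm (indicator (A \<inter> dual_map f -` B) t - P t * Q (dual_map f t)))"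
        using indI[of "A \<inter> dual_map f -` B"]
          trigp_integrable[OF trigp_mult[OF P(1) trigp_dual_map[OF Q(1) zadditive[OF f]]]] by auto
      fix t
      let ?a = "indicator A t :: complex" and ?b = "indicator B (dual_map f t) :: complex"
      have "indicator (A \<inter> dual_map f -` B) t - P t * Q (dual_map f t) =
          (?a - P t) * ?b + P t * (?b - Q (dual_map f t))"
        by (simp add: indicator_def algebra_simps)
      also have "norm \<dots> \<le> norm (?a - P t) * norm ?b + norm (P t) * norm (?b - Q (dual_map f t))"
        by (metis norm_mult norm_triangle_ineq)
      also have "\<dots> \<le> norm (?a - P t) * 1 + 2 * norm (?b - Q (dual_map f t))"
        using P(2)[of t] by (intro add_mono mult_mono) (auto simp: indicator_def)
      finally show "norm (indicator (A \<inter> dual_map f -` B) t - P t * Q (dual_map f t)) \<le>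
          norm (?a - P t) + 2 * norm (?b - Q (dual_map f t))" by simp
    qed (use int1 int2 in auto)
    also have "\<dots> = (\<integral>t. norm (indicator A t - P t) \<partial>torus_haar) +
        2 * (\<integral>t. norm (indicator B (dual_map f t) - Q (dual_map f t)) \<partial>torus_haar)"
      using int1 int2 by simp
    also have "(\<integral>t. norm (indicator B (dual_map f t) - Q (dual_map f t)) \<partial>torus_haar) =
        (\<integral>t. norm (indicator B t - Q t) \<partial>distr torus_haar borel (dual_map f))"
      by (rule integral_distr[symmetric]) auto
    also have "\<dots> = (\<integral>t. norm (indicator B t - Q t) \<partial>torus_haar)"
      by (simp add: distr_dual_map[OF f])
    finally show ?thesis using P(3) Q(3) by simp
  qed
  have "\<bar>measure torus_haar (A \<inter> dual_map f -` B) - measure torus_haar A * measure torus_haar B\<bar> < e"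
    if "f \<in> G" and *: "(\<integral>t. P t * Q (dual_map f t) \<partial>torus_haar) =
      (\<integral>t. P t \<partial>torus_haar) * (\<integral>t. Q t \<partial>torus_haar)" for f
  proof -
    let ?x = "complex_of_real (measure torus_haar (A \<inter> dual_map f -` B))"
    let ?y = "\<integral>t. P t * Q (dual_map f t) \<partial>torus_haar"
    let ?z = "complex_of_real (measure torus_haar A * measure torus_haar B)"
    have "norm (?x - ?z) \<le> norm (?x - ?y) + norm (?y - ?z)"
      using norm_triangle_ineq[of "?x - ?y" "?y - ?z"] by simp
    also have "\<dots> < 3 * (e / 6) + 3 * (e / 6)"
      using main[OF that(1)] prod unfolding * by (rule add_less_le_mono)
    finally have "norm (?x - ?z) < e" by simp
    then show ?thesis by (simp flip: of_real_diff of_real_mult)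
  qed
  then show ?thesis
    by (intro finite_subset[OF _ trigp_decorrelate[OF P(1) Q(1)]]) force
qed

text \<open>Sets of the completion differ from Borel sets by null sets, and preimages of null sets
  under the dual maps are null because Haar measure is preserved.\<close>

lemma mixing_\<Gamma>: "mixing torus_measure \<Gamma>"
  unfolding mixing_def
proof (intro ballI)
  fix A B :: "'n torus set" assume A: "A \<in> sets torus_measure" and B: "B \<in> sets torus_measure"
  obtain S N N' where S: "A = S \<union> N" "N \<subseteq> N'" "N' \<in> null_sets torus_haar" "S \<in> sets torus_haar"
    using sets_completionE[OF A] .
  obtain T L L' where T: "B = T \<union> L" "L \<subseteq> L'" "L' \<in> null_sets torus_haar" "T \<in> sets torus_haar"
    using sets_completionE[OF B] .
  have aeA: "AE x in torus_measure. x \<in> A \<longleftrightarrow> x \<in> S"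
    using AE_completion[OF AE_not_in[OF S(3)]] S(1,2) by (auto elim: AE_mp)
  have aeB: "AE x in torus_measure. x \<in> B \<longleftrightarrow> x \<in> T"
    using AE_completion[OF AE_not_in[OF T(3)]] T(1,2) by (auto elim: AE_mp)
  have mA: "measure torus_measure A = measure torus_haar S"
    using measure_eq_AE[OF aeA A] S(4) by simp
  have mB: "measure torus_measure B = measure torus_haar T"
    using measure_eq_AE[OF aeB B] T(4) by simp
  have mAB: "measure torus_measure (A \<inter> dual_map f -` B) = measure torus_haar (S \<inter> dual_map f -` T)"
    if f: "f \<in> G" for f
  proof -
    have b: "dual_map f -` Y \<in> sets torus_haar" if "Y \<in> sets torus_haar" for Y
      using measurable_sets[OF measurable_dual_map, of Y] that by simp
    have "emeasure torus_haar (dual_map f -` L') = emeasure (distr torus_haar borel (dual_map f)) L'"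
      using T(3) by (subst emeasure_distr) (auto simp: null_sets_def)
    then have null: "dual_map f -` L' \<in> null_sets torus_haar"
      using T(3) b by (auto simp: distr_dual_map[OF f] null_sets_def)
    have "dual_map f -` B = dual_map f -` T \<union> dual_map f -` L" by (auto simp: T(1))
    then have Bm: "dual_map f -` B \<in> sets torus_measure"
      using T b null by (intro sets_completionI[of _ "dual_map f -` T" "dual_map f -` L" "dual_map f -` L'"]) auto
    have "AE x in torus_measure. x \<notin> dual_map f -` L'"
      by (rule AE_completion[OF AE_not_in[OF null]])
    with aeA have "AE x in torus_measure. x \<in> A \<inter> dual_map f -` B \<longleftrightarrow> x \<in> S \<inter> dual_map f -` T"
      by eventually_elim (use T in auto)
    then have "measure torus_measure (A \<inter> dual_map f -` B) = measure torus_measure (S \<inter> dual_map f -` T)"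
      using A Bm S(4) b[OF T(4)] by (intro measure_eq_AE) auto
    also have "\<dots> = measure torus_haar (S \<inter> dual_map f -` T)"
      using S(4) b[OF T(4)] by (intro measure_completion) auto
    finally show ?thesis .
  qed
  show "((\<lambda>\<gamma>. measure torus_measure (A \<inter> (\<gamma> -` B \<inter> space torus_measure))) \<longlongrightarrow>
      measure torus_measure A * measure torus_measure B) (inf cofinite (principal \<Gamma>))"
  proof (rule tendstoI)
    fix e :: real assume e: "0 < e"
    have "{\<gamma>. \<not> (\<gamma> \<in> \<Gamma> \<longrightarrow> dist (measure torus_measure (A \<inter> (\<gamma> -` B \<inter> space torus_measure)))
        (measure torus_measure A * measure torus_measure B) < e)} \<subseteq>
      dual_map ` {f \<in> G. e \<le> \<bar>measure torus_haar (S \<inter> dual_map f -` T) -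
        measure torus_haar S * measure torus_haar T\<bar>}"
      by (auto simp: \<Gamma>_def mA mB mAB dist_real_def not_less)
    then have "finite {\<gamma>. \<not> (\<gamma> \<in> \<Gamma> \<longrightarrow> dist (measure torus_measure (A \<inter> (\<gamma> -` B \<inter> space torus_measure)))
        (measure torus_measure A * measure torus_measure B) < e)}"
      using mixing_estimate[of S T e] S(4) T(4) e by (auto intro: finite_subset)
    then show "\<forall>\<^sub>F \<gamma> in inf cofinite (principal \<Gamma>).
        dist (measure torus_measure (A \<inter> (\<gamma> -` B \<inter> space torus_measure)))
          (measure torus_measure A * measure torus_measure B) < e"
      unfolding eventually_inf_principal eventually_cofinite .
  qed
qed

section \<open>Failure of mixing of order 3\<close>

definition quadrant :: "int ^ 'n \<Rightarrow> 'n torus set" where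
  "quadrant v = {t. 0 < Re (chr v t) \<and> 0 < Im (chr v t)}"

lemma open_quadrant: "open (quadrant v)"
  unfolding quadrant_def
  by (intro open_Collect_conj open_Collect_less continuous_intros continuous_on_chr)

lemma quadrant_nonempty:
  assumes "v \<noteq> 0"
  shows "quadrant v \<noteq> {}"
proof -
  define r where "r = ip v (\<chi> j. of_int (v $ j))"
  have "0 < r" unfolding r_def by (rule ip_self_pos[OF assms])
  then have "chr v (to_torus ((1 / (8 * r)) *\<^sub>R (\<chi> j. of_int (v $ j)))) = cis (pi / 4)"
    by (simp add: chr_to_torus ip_scale_right flip: r_def)
  then have "to_torus ((1 / (8 * r)) *\<^sub>R (\<chi> j. of_int (v $ j))) \<in> quadrant v"
    by (simp add: quadrant_def sin_45 cos_45)
  then show ?thesis by blast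
qed

text \<open>Three angles in the open interval from 0 to pi/2 have a sum strictly between 0 and 3
  pi/2, which is no multiple of 2 pi.\<close>

lemma quadrant_product:
  assumes "x \<in> quadrant u" "y \<in> quadrant v" "z \<in> quadrant w"
  shows "chr u x * chr v y * chr w z \<noteq> 1"
proof
  assume eq: "chr u x * chr v y * chr w z = 1"
  have "chr w z * cnj (chr w z) = 1"
    by (metis complex_norm_square mult_1 norm_chr of_real_1 power_one)
  then have "chr u x * chr v y = cnj (chr w z)"
    using eq by (metis mult.assoc mult.right_neutral mult_1)
  then have "Re (chr u x) * Im (chr v y) + Im (chr u x) * Re (chr v y) = - Im (chr w z)"
    by (auto dest: arg_cong[of _ _ Im])
  moreover have "0 < Re (chr u x) * Im (chr v y)" "0 < Im (chr u x) * Re (chr v y)"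
    "0 < Im (chr w z)"
    using assms by (auto simp: quadrant_def)
  ultimately show False by linarith
qed

text \<open>The relation makes the product of the three characters along the orbit identically 1, so
  no point visits the three quadrants \<open>quadrant a\<close>, \<open>quadrant b\<close>,
  \<open>quadrant c\<close> in turn. The intersection is empty although the product of the three
  measures is positive. Injectivity of the three sequences lets \<open>n\<close> be chosen so that
  all products avoid a given finite set.\<close>

lemma not_mixing_of_order_3:
  assumes P: "\<And>n. P n \<in> G" "inj P" and R: "\<And>n. R n \<in> G" "inj R"
    and inj: "inj (\<lambda>n. P n \<circ> R n)"
    and nz: "a \<noteq> 0" "b \<noteq> 0" "c \<noteq> 0"
    and rel: "\<And>n :: nat. a + P n b + P n (R n c) = 0"
  shows "\<not> mixing_of_order 3 torus_measure \<Gamma>"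
proof
  assume mix: "mixing_of_order 3 torus_measure \<Gamma>"
  define B where "B i = (if i = Suc 0 then quadrant a else if i = 2 then quadrant b else quadrant c)"
    for i :: nat
  have Bm: "B i \<in> sets torus_haar" for i
    by (auto simp: B_def open_quadrant borel_open)
  define \<epsilon> where "\<epsilon> = (\<Prod>i\<in>{1..3}. measure torus_measure (B i))"
  have "0 < measure torus_measure (B i)" for i
    using Bm[of i] haar_open_pos[OF open_quadrant quadrant_nonempty] nz
    by (simp add: B_def)
  then have \<epsilon>: "0 < \<epsilon>" unfolding \<epsilon>_def by (intro prod_pos) simp
  have "\<forall>i\<in>{1..3}. B i \<in> sets torus_measure" using Bm by blast
  from mix[unfolded mixing_of_order_def, THEN spec, THEN mp, OF this, THEN spec, THEN mp, OF \<epsilon>, folded \<epsilon>_def]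
  obtain K where K: "finite K"
    "\<forall>\<gamma>. (\<forall>i\<in>{1..3}. \<gamma> i \<in> \<Gamma>) \<longrightarrow>
      (\<forall>i j. 1 < i \<and> i \<le> j \<and> j \<le> 3 \<longrightarrow> iterated_comp \<gamma> i j \<notin> K) \<longrightarrow>
      \<bar>measure torus_measure {x\<in>space torus_measure. \<forall>i\<in>{1..3}. iterated_comp \<gamma> 1 i x \<in> B i} - \<epsilon>\<bar> < \<epsilon>"
    by (elim exE conjE) (rule that)
  have fin: "finite {n. dual_map (F n) \<in> K}" if "\<And>n. F n \<in> G" "inj F" for F :: "nat \<Rightarrow> _"
  proof -
    have "inj (\<lambda>n. dual_map (F n))"
      using that dual_map_injective zadditive unfolding inj_def by blast
    then show ?thesis using finite_vimageI[OF K(1)] by (simp add: vimage_def)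
  qed
  have "finite ({n. dual_map (P n) \<in> K} \<union> {n. dual_map (R n) \<in> K} \<union> {n. dual_map (P n \<circ> R n) \<in> K})"
    using P R inj by (intro finite_UnI fin comp_mem) auto
  from ex_new_if_finite[OF infinite_UNIV_nat this]
  obtain n where n: "dual_map (P n) \<notin> K" "dual_map (R n) \<notin> K" "dual_map (P n \<circ> R n) \<notin> K"
    by auto
  \<comment> \<open>The identity is admissible as first map, since only products that begin at index
    2 or 3 must leave \<open>K\<close>.\<close>
  define \<gamma> where "\<gamma> i = (if i = Suc 0 then id else if i = 2 then dual_map (P n) else dual_map (R n))"
    for i :: nat
  have comp: "dual_map (R n) \<circ> dual_map (P n) = dual_map (P n \<circ> R n)"
    using P R zadditive by (simp add: dual_map_comp)
  have it: "iterated_comp \<gamma> (Suc 0) (Suc 0) = id" "iterated_comp \<gamma> (Suc 0) 2 = dual_map (P n)"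
    "iterated_comp \<gamma> (Suc 0) 3 = dual_map (P n \<circ> R n)"
    "iterated_comp \<gamma> 2 2 = dual_map (P n)" "iterated_comp \<gamma> 3 3 = dual_map (R n)"
    "iterated_comp \<gamma> 2 3 = dual_map (P n \<circ> R n)"
    by (simp_all add: iterated_comp_def \<gamma>_def comp numeral_2_eq_2 numeral_3_eq_3)
  have "\<forall>i\<in>{1..3}. \<gamma> i \<in> \<Gamma>"
    using P R imageI[OF id_mem, of dual_map] by (auto simp: \<gamma>_def \<Gamma>_def dual_map_id)
  moreover have "\<forall>i j. 1 < i \<and> i \<le> j \<and> j \<le> 3 \<longrightarrow> iterated_comp \<gamma> i j \<notin> K"
  proof (intro allI impI)
    fix i j :: nat assume "1 < i \<and> i \<le> j \<and> j \<le> 3"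
    then have "(i = 2 \<and> j = 2) \<or> (i = 2 \<and> j = 3) \<or> (i = 3 \<and> j = 3)" by auto
    then show "iterated_comp \<gamma> i j \<notin> K" using n it by auto
  qed
  ultimately have "\<bar>measure torus_measure {x\<in>space torus_measure. \<forall>i\<in>{1..3}. iterated_comp \<gamma> 1 i x \<in> B i} - \<epsilon>\<bar> < \<epsilon>"
    by (rule K(2)[THEN spec, THEN mp, THEN mp])
  moreover have "{x\<in>space torus_measure. \<forall>i\<in>{1..3}. iterated_comp \<gamma> 1 i x \<in> B i} = {}"
  proof -
    have False if x: "\<forall>i\<in>{1..3}. iterated_comp \<gamma> 1 i x \<in> B i" for x
    proof -
      have "x \<in> quadrant a" "dual_map (P n) x \<in> quadrant b" "dual_map (P n \<circ> R n) x \<in> quadrant c"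
        using x[rule_format, of 1] x[rule_format, of 2] x[rule_format, of 3] it
        by (simp_all add: B_def)
      from quadrant_product[OF this]
      have "chr a x * chr (P n b) x * chr (P n (R n c)) x \<noteq> 1"
        using P R zadditive comp_mem by (simp add: chr_dual_map)
      moreover have "chr a x * chr (P n b) x * chr (P n (R n c)) x = chr (a + P n b + P n (R n c)) x"
        by (simp add: chr_add_index)
      ultimately show False by (simp add: rel)
    qed
    then show ?thesis by blast
  qed
  ultimately have "\<bar>measure torus_measure ({} :: 'n torus set) - \<epsilon>\<bar> < \<epsilon>" by (simp only:)
  then show False by simp
qed

lemma dual_map_funpow: "f \<in> G \<Longrightarrow> f ^^ n \<in> G \<and> dual_map f ^^ n = dual_map (f ^^ n)"
proof (induction n)
  case 0
  then show ?case using id_mem by (simp add: id_def dual_map_id[unfolded id_def])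
next
  case (Suc n)
  then have "dual_map f ^^ Suc n = dual_map f \<circ> dual_map (f ^^ n)" by simp
  also have "\<dots> = dual_map (f ^^ n \<circ> f)" using Suc by (simp add: dual_map_comp zadditive)
  finally show ?case using Suc by (simp add: comp_mem funpow_Suc_right[symmetric] del: funpow.simps)
    (simp add: comp_mem)
qed

text \<open>A subgroup of finite index contains positive powers of both elements, and these would
  have to commute.\<close>

lemma not_virtually_abelian:
  assumes f: "f \<in> G" and g: "g \<in> G"
    and nc: "\<And>n m. 1 \<le> n \<Longrightarrow> 1 \<le> m \<Longrightarrow> f ^^ n \<circ> g ^^ m \<noteq> g ^^ m \<circ> f ^^ n"
  shows "\<not> virtually_abelian (torus_Aut\<lparr>carrier := \<Gamma>\<rparr>)"
proof
  let ?\<Gamma> = "torus_Aut\<lparr>carrier := \<Gamma>\<rparr>"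
  assume "virtually_abelian ?\<Gamma>"
  then obtain H where H: "subgroup H ?\<Gamma>" "comm_group (?\<Gamma>\<lparr>carrier := H\<rparr>)" "finite (rcosets\<^bsub>?\<Gamma>\<^esub> H)"
    by (auto simp: virtually_abelian_def)
  have gr: "group ?\<Gamma>"
    using subgroup.subgroup_is_group[OF subgroup_\<Gamma> group_torus_Aut] .
  have pow: "x [^]\<^bsub>?\<Gamma>\<^esub> n = x ^^ n" for x and n :: nat
    by (induction n) (simp_all add: torus_Aut_def nat_pow_def funpow_swap1 fun_eq_iff)
  have mem: "dual_map f \<in> carrier ?\<Gamma>" "dual_map g \<in> carrier ?\<Gamma>" using f g by (auto simp: \<Gamma>_def)
  obtain n where n: "1 \<le> n" "dual_map f ^^ n \<in> H"
    using subgroup_finite_index_power[OF gr H(1,3) mem(1)] pow by metis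
  obtain m where m: "1 \<le> m" "dual_map g ^^ m \<in> H"
    using subgroup_finite_index_power[OF gr H(1,3) mem(2)] pow by metis
  have "dual_map f ^^ n \<circ> dual_map g ^^ m = dual_map g ^^ m \<circ> dual_map f ^^ n"
    using comm_monoid.m_comm[OF comm_group.axioms(1)[OF H(2)], of "dual_map f ^^ n" "dual_map g ^^ m"]
      n m by (simp add: torus_Aut_def)
  then have "dual_map (g ^^ m \<circ> f ^^ n) = dual_map (f ^^ n \<circ> g ^^ m)"
    using dual_map_funpow f g zadditive by (simp add: dual_map_comp)
  then have "g ^^ m \<circ> f ^^ n = f ^^ n \<circ> g ^^ m"
    using dual_map_funpow f g zadditive comp_mem by (intro dual_map_injective) auto
  then show False using nc[OF n(1) m(1)] by simp
qed


text \<open>If the conjugates by \<open>g ^^ i\<close> and \<open>g ^^ (i + m)\<close> agree,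
  cancelling \<open>g ^^ i\<close> shows that \<open>f\<close> commutes with
  \<open>g ^^ m\<close>.\<close>

lemma conjugates_injective:
  fixes f g g' :: "int ^ 'n \<Rightarrow> int ^ 'n"
  assumes inv: "g \<circ> g' = id" "g' \<circ> g = id"
    and nc: "\<And>m. 1 \<le> m \<Longrightarrow> f \<circ> g ^^ m \<noteq> g ^^ m \<circ> f"
  shows "inj (\<lambda>j. g ^^ j \<circ> f \<circ> g' ^^ j)"
proof (rule linorder_injI)
  have c1: "(g' ^^ i) ((g ^^ i) v) = v" for i v
    using inv(2) by (induction i arbitrary: v) (simp_all add: funpow_swap1 fun_eq_iff)
  have c2: "(g' ^^ (i + k)) ((g ^^ i) v) = (g' ^^ k) v" for i k v
    using c1[of i v] by (simp add: add.commute[of i] funpow_add)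
  fix i j :: nat assume "i < j"
  then obtain m where m: "j = i + m" "1 \<le> m"
    by (metis One_nat_def Suc_leI less_imp_add_positive)
  show "g ^^ i \<circ> f \<circ> g' ^^ i \<noteq> g ^^ j \<circ> f \<circ> g' ^^ j"
  proof
    assume eq: "g ^^ i \<circ> f \<circ> g' ^^ i = g ^^ j \<circ> f \<circ> g' ^^ j"
    have "(f \<circ> g ^^ m) v = (g ^^ m \<circ> f) v" for v
    proof -
      have "(g' ^^ i) ((g ^^ i \<circ> f \<circ> g' ^^ i) ((g ^^ j) v)) =
          (g' ^^ i) ((g ^^ j \<circ> f \<circ> g' ^^ j) ((g ^^ j) v))"
        by (simp only: eq)
      then show ?thesis
        by (simp only: comp_apply c1) (simp add: m(1) funpow_add c1)
    qed
    then show False using nc[OF m(2)] by (simp add: fun_eq_iff)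
  qed
qed

text \<open>The two steps are the conjugates of \<open>f\<close> and of \<open>f ^^ (r - 1)\<close>
  by the same power of \<open>g\<close>; their composite is the conjugate of \<open>f ^^ r\<close>.
  Since \<open>2 \<le> r\<close>, all three exponents are positive and the three families are
  injective.\<close>

lemma witness:
  assumes f: "f \<in> G" and g: "g \<in> G" "g' \<in> G" "g \<circ> g' = id" "g' \<circ> g = id"
    and nc: "\<And>n m. 1 \<le> n \<Longrightarrow> 1 \<le> m \<Longrightarrow> f ^^ n \<circ> g ^^ m \<noteq> g ^^ m \<circ> f ^^ n"
    and r: "2 \<le> r" and nz: "a \<noteq> 0" "b \<noteq> 0" "c \<noteq> 0"
    and rel: "\<And>j. a + (g ^^ j) (f ((g' ^^ j) b)) + (g ^^ j) ((f ^^ r) ((g' ^^ j) c)) = 0"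
  shows "\<exists>\<Gamma>. subgroup \<Gamma> (torus_Aut :: ('n torus \<Rightarrow> 'n torus) monoid) \<and>
           \<not> virtually_abelian ((torus_Aut :: ('n torus \<Rightarrow> 'n torus) monoid)\<lparr>carrier := \<Gamma>\<rparr>) \<and>
           mixing torus_measure \<Gamma> \<and>
           \<not> mixing_of_order 3 torus_measure \<Gamma>"
proof (intro exI conjI)
  define C where "C k j = g ^^ j \<circ> f ^^ k \<circ> g' ^^ j" for k j
  have C_mem: "C k j \<in> G" for k j
    unfolding C_def using dual_map_funpow f g by (intro comp_mem) blast+
  have C_inj: "inj (C k)" if "1 \<le> k" for k
    unfolding C_def using that nc by (intro conjugates_injective g) auto
  have c1: "(g' ^^ i) ((g ^^ i) v) = v" for i v
    using g(4) by (induction i arbitrary: v) (simp_all add: funpow_swap1 fun_eq_iff)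
  have C_comp: "C 1 j \<circ> C (r - 1) j = C r j" for j
  proof
    fix v
    have "f ^^ r = f \<circ> f ^^ (r - 1)" using r by (cases r) auto
    then show "(C 1 j \<circ> C (r - 1) j) v = C r j v" by (simp add: C_def c1)
  qed
  show "\<not> mixing_of_order 3 torus_measure \<Gamma>"
  proof (rule not_mixing_of_order_3[of "C 1" "C (r - 1)" a b c])
    show "inj (\<lambda>n. C 1 n \<circ> C (r - 1) n)" using C_inj[of r] r unfolding C_comp by simp
    show "a + C 1 n b + C 1 n (C (r - 1) n c) = 0" for n
      using rel[of n] C_comp[of n] by (simp add: C_def fun_eq_iff)
  qed (use C_mem C_inj nz r in auto)
qed (use subgroup_\<Gamma> mixing_\<Gamma> not_virtually_abelian[OF f g(1) nc] in auto)

end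

text \<open>The maps in \<open>S\<close> may live on an ambient group much larger than the lattice,
  so that a single action serves every dimension. They are pulled back through
  \<open>\<psi>\<close>; freeness and noncommutation are therefore required only on
  \<open>range \<psi>\<close>.\<close>

lemma witness_from_module:
  fixes \<psi> :: "int ^ 'n::finite \<Rightarrow> 'm::ab_group_add" and S :: "('m \<Rightarrow> 'm) set"
  assumes \<psi>: "\<And>v w. \<psi> (v + w) = \<psi> v + \<psi> w" "inj \<psi>"
    and additive: "\<And>s x y. s \<in> S \<Longrightarrow> s (x + y) = s x + s y"
    and id: "id \<in> S" and comp: "\<And>s t. s \<in> S \<Longrightarrow> t \<in> S \<Longrightarrow> s \<circ> t \<in> S"
    and inverse: "\<And>s. s \<in> S \<Longrightarrow> \<exists>t\<in>S. s \<circ> t = id \<and> t \<circ> s = id"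
    and invariant: "\<And>s v. s \<in> S \<Longrightarrow> s (\<psi> v) \<in> range \<psi>"
    and free: "\<And>s v. s \<in> S \<Longrightarrow> s (\<psi> v) = \<psi> v \<Longrightarrow> v \<noteq> 0 \<Longrightarrow> s \<circ> \<psi> = \<psi>"
    and f: "f \<in> S" and g: "g \<in> S" "g' \<in> S" "g \<circ> g' = id" "g' \<circ> g = id"
    and nc: "\<And>n m. 1 \<le> n \<Longrightarrow> 1 \<le> m \<Longrightarrow> f ^^ n \<circ> g ^^ m \<circ> \<psi> \<noteq> g ^^ m \<circ> f ^^ n \<circ> \<psi>"
    and r: "2 \<le> r" and abc: "a \<in> range \<psi>" "b \<in> range \<psi>" "c \<in> range \<psi>"
    and nz: "a \<noteq> 0" "b \<noteq> 0" "c \<noteq> 0"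
    and rel: "\<And>j. a + (g ^^ j) (f ((g' ^^ j) b)) + (g ^^ j) ((f ^^ r) ((g' ^^ j) c)) = 0"
  shows "\<exists>\<Gamma>. subgroup \<Gamma> (torus_Aut :: ('n torus \<Rightarrow> 'n torus) monoid) \<and>
           \<not> virtually_abelian ((torus_Aut :: ('n torus \<Rightarrow> 'n torus) monoid)\<lparr>carrier := \<Gamma>\<rparr>) \<and>
           mixing torus_measure \<Gamma> \<and>
           \<not> mixing_of_order 3 torus_measure \<Gamma>"
proof -
  define L where "L s v = inv_into UNIV \<psi> (s (\<psi> v))" for s v
  have L: "\<psi> (L s v) = s (\<psi> v)" if "s \<in> S" for s v
    unfolding L_def using invariant[OF that] by (rule f_inv_into_f)
  have eqI: "v = w" if "\<psi> v = \<psi> w" for v w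
    using \<psi>(2) that by (rule injD)
  have \<psi>0: "\<psi> 0 = 0" using \<psi>(1)[of 0 0] by simp
  have L_comp: "L s \<circ> L t = L (s \<circ> t)" if "s \<in> S" "t \<in> S" for s t
    using that comp[OF that] by (intro ext eqI) (simp add: L)
  have L_id: "L id = id"
    using id by (intro ext eqI) (simp add: L)
  have pow: "s ^^ k \<in> S \<and> L s ^^ k = L (s ^^ k)" if "s \<in> S" for s k
  proof (induction k)
    case 0
    show ?case using id by (simp add: id_def L_id[unfolded id_def])
  next
    case (Suc k)
    then show ?case
      using comp[OF that, of "s ^^ k"] L_comp[OF that, of "s ^^ k"]
      by (simp only: funpow.simps simp_thms)
  qed
  interpret dual_group "L ` S"
  proof
    fix F assume "F \<in> L ` S"
    then obtain s where s: "s \<in> S" "F = L s" by blast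
    show "zadditive F"
      unfolding zadditive_def by (intro allI eqI) (simp add: s L \<psi>(1) additive)
    obtain t where t: "t \<in> S" "s \<circ> t = id" "t \<circ> s = id" using inverse s by blast
    then show "\<exists>h\<in>L ` S. F \<circ> h = id \<and> h \<circ> F = id"
      using s by (intro bexI[of _ "L t"]) (auto simp: L_comp L_id)
    show "F = id" if "F v = v" "v \<noteq> 0" for v
    proof -
      have "s (\<psi> v) = \<psi> v" using that s L by metis
      then have "s \<circ> \<psi> = \<psi>" using free that s by blast
      then show ?thesis
        using s by (intro ext eqI) (simp add: L fun_eq_iff)
    qed
    show "F \<circ> F' \<in> L ` S" if "F' \<in> L ` S" for F'
      using that s by (auto simp: L_comp comp)
  next
    show "id \<in> L ` S" using id L_id by (metis imageI)
  qed
  obtain a0 b0 c0 where abc0: "a = \<psi> a0" "b = \<psi> b0" "c = \<psi> c0" using abc by blast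
  show ?thesis
  proof (rule witness[of "L f" "L g" "L g'" r a0 b0 c0])
    show "L f ^^ n \<circ> L g ^^ m \<noteq> L g ^^ m \<circ> L f ^^ n" if "1 \<le> n" "1 \<le> m" for n m
    proof
      assume "L f ^^ n \<circ> L g ^^ m = L g ^^ m \<circ> L f ^^ n"
      then have "L (f ^^ n \<circ> g ^^ m) = L (g ^^ m \<circ> f ^^ n)"
        using pow f g by (simp add: L_comp)
      then have "\<psi> (L (f ^^ n \<circ> g ^^ m) v) = \<psi> (L (g ^^ m \<circ> f ^^ n) v)" for v by simp
      then show False
        using nc[OF that] pow f g comp by (simp add: L fun_eq_iff)
    qed
    show "a0 + (L g ^^ j) (L f ((L g' ^^ j) b0)) + (L g ^^ j) ((L f ^^ r) ((L g' ^^ j) c0)) = 0" for j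
      using rel[of j] pow f g by (intro eqI) (simp add: \<psi> \<psi>0 L abc0)
  qed (use f g nz r abc0 \<psi>0 L_comp L_id in auto)
qed

subsection \<open>Words and a free group of hyperbolic matrices\<close>

text \<open>The first component selects one of two generators, the second is \<open>False\<close> for its inverse.\<close>

type_synonym letter = "bool \<times> bool"

fun flip :: "letter \<Rightarrow> letter" where
  "flip (x, s) = (x, \<not> s)"

lemma flip_flip [simp]: "flip (flip l) = l" and flip_neq [simp]: "flip l \<noteq> l"
  by (cases l; simp)+

lemma flip_eq_iff: "flip l = k \<longleftrightarrow> l = flip k"
  by auto

definition reduced :: "letter list \<Rightarrow> bool" where
  "reduced = successively (\<lambda>l k. k \<noteq> flip l)"

lemma reduced_simps [simp]:
  "reduced []" "reduced [l]" "reduced (l # k # ws) \<longleftrightarrow> k \<noteq> flip l \<and> reduced (k # ws)"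
  by (simp_all add: reduced_def)

lemma reduced_append:
  "reduced (xs @ ys) \<longleftrightarrow>
    reduced xs \<and> reduced ys \<and> (xs \<noteq> [] \<longrightarrow> ys \<noteq> [] \<longrightarrow> hd ys \<noteq> flip (last xs))"
  unfolding reduced_def by (subst successively_append_iff) auto

lemma reduced_ConsD: "reduced (l # ws) \<Longrightarrow> reduced ws"
  by (cases ws) auto

definition inverse_word :: "letter list \<Rightarrow> letter list" where
  "inverse_word ws = rev (map flip ws)"

lemma reduced_inverse_word: "reduced ws \<Longrightarrow> reduced (inverse_word ws)"
  unfolding inverse_word_def reduced_def
  by (simp add: successively_rev successively_map) (erule successively_mono, auto)

lemma reduced_replicate: "reduced (replicate n l)"
proof (induction n)
  case (Suc n)
  then show ?case by (cases n) (auto simp: flip_eq_iff dest: sym)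
qed simp

text \<open>Prefixing a letter to a reduced word either keeps it reduced or cancels its head. This
  reduces freeness of the whole group to nonempty reduced words.\<close>

lemma exists_reduced:
  "\<exists>us. reduced us \<and>
    (\<forall>\<phi> :: letter \<Rightarrow> 'a \<Rightarrow> 'a. (\<forall>l x. \<phi> l (\<phi> (flip l) x) = x) \<longrightarrow> foldr \<phi> ws = foldr \<phi> us)"
proof (induction ws)
  case (Cons l ws)
  then obtain us where us: "reduced us"
    "\<And>\<phi> :: letter \<Rightarrow> 'a \<Rightarrow> 'a. (\<forall>l x. \<phi> l (\<phi> (flip l) x) = x) \<Longrightarrow> foldr \<phi> ws = foldr \<phi> us"
    by blast
  show ?case
  proof (cases "us \<noteq> [] \<and> hd us = flip l")
    case True
    then obtain vs where vs: "us = flip l # vs" by (metis list.exhaust_sel)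
    show ?thesis
    proof (intro exI conjI allI impI)
      show "reduced vs" using us(1) reduced_ConsD vs by blast
      fix \<phi> :: "letter \<Rightarrow> 'a \<Rightarrow> 'a" assume inv: "\<forall>l x. \<phi> l (\<phi> (flip l) x) = x"
      show "foldr \<phi> (l # ws) = foldr \<phi> vs"
        using us(2)[OF inv] inv by (auto simp only: vs fun_eq_iff foldr.simps comp_apply)
    qed
  next
    case False
    then have "reduced (l # us)" using us(1) by (cases us) auto
    then show ?thesis
      using us(2) by (intro exI[of _ "l # us"]) (auto simp: fun_eq_iff)
  qed
qed (auto intro: exI[of _ "[]"])

lemma foldr_inverse_word:
  assumes "\<And>l x. \<phi> l (\<phi> (flip l) x) = x"
  shows "foldr \<phi> (inverse_word ws) (foldr \<phi> ws x) = x"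
    and "foldr \<phi> ws (foldr \<phi> (inverse_word ws) x) = x"
proof -
  have 1: "foldr \<phi> (inverse_word ws) (foldr \<phi> ws x) = x" for ws x
  proof (induction ws)
    case (Cons l ws)
    then show ?case using assms[of "flip l"] by (simp add: inverse_word_def)
  qed (simp add: inverse_word_def)
  have 2: "inverse_word (inverse_word ws) = ws"
    by (simp add: inverse_word_def rev_map comp_def)
  show "foldr \<phi> (inverse_word ws) (foldr \<phi> ws x) = x" by (rule 1)
  show "foldr \<phi> ws (foldr \<phi> (inverse_word ws) x) = x" using 1[of "inverse_word ws"] by (simp add: 2)
qed

text \<open>The commutator of the powers of the two generators. Being reduced and nonempty for
  \<open>1 \<le> n\<close> and \<open>1 \<le> m\<close>, it cannot act trivially, which is how
  noncommutation of powers is obtained.\<close>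

definition commutator_word :: "nat \<Rightarrow> nat \<Rightarrow> letter list" where
  "commutator_word n m = replicate n (False, True) @ replicate m (True, True) @
     replicate n (False, False) @ replicate m (True, False)"

lemma reduced_commutator_word:
  assumes "1 \<le> n" "1 \<le> m"
  shows "reduced (commutator_word n m)" "commutator_word n m \<noteq> []"
  using assms by (auto simp: commutator_word_def reduced_append reduced_replicate hd_append)

lemma foldr_commutator_word:
  "foldr \<phi> (commutator_word n m) x = (\<phi> (False, True) ^^ n) ((\<phi> (True, True) ^^ m)
    ((\<phi> (False, False) ^^ n) ((\<phi> (True, False) ^^ m) x)))"
proof -
  have "foldr \<phi> (replicate n l) y = (\<phi> l ^^ n) y" for n l y
    by (induction n) auto
  then show ?thesis by (simp add: commutator_word_def)
qed

text \<open>Among four letters there is one, \<open>l\<close>, different from the head of the word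
  and from the inverse of its last letter. A point of \<open>X l\<close> is carried into the set of
  the head, which is disjoint from \<open>X l\<close>.\<close>

lemma ping_pong:
  fixes \<phi> :: "letter \<Rightarrow> 'a \<Rightarrow> 'a" and X :: "letter \<Rightarrow> 'a set"
  assumes ws: "reduced ws" "ws \<noteq> []"
    and move: "\<And>k l x. k \<noteq> flip l \<Longrightarrow> x \<in> X l \<Longrightarrow> \<phi> k x \<in> X k"
    and disj: "\<And>k l. k \<noteq> l \<Longrightarrow> X k \<inter> X l = {}" and ne: "\<And>l. X l \<noteq> {}"
  shows "foldr \<phi> ws \<noteq> id"
proof
  assume id: "foldr \<phi> ws = id"
  have step: "foldr \<phi> ws x \<in> X (hd ws)"
    if "reduced ws" "ws \<noteq> []" "last ws \<noteq> flip l" "x \<in> X l" for ws l x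
    using that
  proof (induction ws)
    case (Cons k ws)
    show ?case
    proof (cases ws)
      case Nil
      then show ?thesis using Cons.prems by (auto intro: move)
    next
      case (Cons k' ws')
      then have "foldr \<phi> ws x \<in> X k'"
        using Cons.IH Cons.prems reduced_ConsD by fastforce
      moreover have "k \<noteq> flip k'" using Cons Cons.prems by auto
      ultimately show ?thesis using move by auto
    qed
  qed simp
  obtain l where l: "l \<noteq> hd ws" "l \<noteq> flip (last ws)"
  proof -
    have "card {hd ws, flip (last ws)} < card (UNIV :: letter set)"
      by (simp add: card_insert_if card_cartesian_product flip: UNIV_Times_UNIV)
    then have "UNIV \<noteq> {hd ws, flip (last ws)}" by (metis less_irrefl)
    then show thesis using that by blast
  qed
  obtain x where x: "x \<in> X l" using ne by blast
  have "foldr \<phi> ws x \<in> X (hd ws)"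
    using l(2) by (intro step[OF ws _ x]) (auto simp: flip_eq_iff)
  then show False using disj[OF l(1)] x id by auto
qed

section \<open>Two hyperbolic matrices and the absence of fixed vectors\<close>

fun sl2 :: "letter \<Rightarrow> int \<times> int \<Rightarrow> int \<times> int" where
  "sl2 (False, True) (x, y) = (5 * x + 2 * y, 2 * x + y)"
| "sl2 (False, False) (x, y) = (x - 2 * y, - 2 * x + 5 * y)"
| "sl2 (True, True) (x, y) = (5 * x - 2 * y, - 2 * x + y)"
| "sl2 (True, False) (x, y) = (x + 2 * y, 2 * x + 5 * y)"

lemma letter_cases:
  obtains "l = (False, True)" | "l = (False, False)" | "l = (True, True)" | "l = (True, False)"
  by (cases l; cases "fst l"; cases "snd l") auto

lemma sl2_flip: "sl2 l (sl2 (flip l) v) = v"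
  by (cases v; rule letter_cases[of l]) auto

lemma sl2_add: "sl2 l (v + w) = sl2 l v + sl2 l w"
  by (cases v; cases w; rule letter_cases[of l]) auto

lemma sl2_zero_iff: "sl2 l v = 0 \<longleftrightarrow> v = 0"
proof -
  have "sl2 l 0 = 0" for l using sl2_add[of l 0 0] by simp
  then show ?thesis using sl2_flip[of "flip l" v] by (metis flip_flip)
qed

definition sqnorm :: "int \<times> int \<Rightarrow> int" where
  "sqnorm v = fst v * fst v + snd v * snd v"

text \<open>The four matrices are symmetric, with expanding directions 45 degrees apart; each of them
  shrinks vectors only in a cone of half-angle less than 22.5 degrees.\<close>

lemma sl2_expands:
  assumes "v \<noteq> 0" "l \<noteq> k"
  shows "sqnorm v < sqnorm (sl2 l v) \<or> sqnorm v < sqnorm (sl2 k v)"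
proof -
  obtain x y where v: "v = (x, y)" by (cases v)
  \<comment> \<open>In the squares and the product of the coordinates the claim is linear; the only
    nonlinear input is that twice the product is at most the sum of the squares in absolute
    value.\<close>
  define p q r where pqr: "p = x * x" "q = y * y" "r = x * y"
  have 1: "0 < p + q"
    using assms(1) by (auto simp: v pqr zero_prod_def sum_power2_gt_zero_iff simp flip: power2_eq_square)
  have 2: "0 \<le> p" "0 \<le> q" by (simp_all add: pqr)
  have "0 \<le> (x + y) * (x + y)" "0 \<le> (x - y) * (x - y)" by simp_all
  then have 3: "- (p + q) \<le> 2 * r" "2 * r \<le> p + q"
    by (simp_all add: pqr algebra_simps)
  have 4: "sqnorm (sl2 (False, True) v) = 29 * p + 24 * r + 5 * q"
    "sqnorm (sl2 (False, False) v) = 5 * p - 24 * r + 29 * q"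
    "sqnorm (sl2 (True, True) v) = 29 * p - 24 * r + 5 * q"
    "sqnorm (sl2 (True, False) v) = 5 * p + 24 * r + 29 * q"
    "sqnorm v = p + q"
    by (simp_all add: sqnorm_def v pqr algebra_simps)
  show ?thesis
    using assms(2) 1 2 3
    by (cases l rule: letter_cases; cases k rule: letter_cases; simp only: 4; (linarith | simp))
qed

text \<open>Expansion, once begun, never stops. After an expanding letter \<open>l\<close> its
  inverse shrinks the vector, so by \<open>sl2_expands\<close> every other letter expands it, and a
  reduced word never continues with the inverse. The second conjunct carries this through the
  induction.\<close>

lemma sl2_growth:
  assumes "reduced ws" "ws \<noteq> []" "v \<noteq> 0" "sqnorm v < sqnorm (sl2 (last ws) v)"
  shows "sqnorm v < sqnorm (foldr sl2 ws v) \<and>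
    sqnorm (sl2 (flip (hd ws)) (foldr sl2 ws v)) < sqnorm (foldr sl2 ws v)"
  using assms
proof (induction ws)
  case (Cons k ws)
  show ?case
  proof (cases ws)
    case Nil
    then show ?thesis using Cons.prems sl2_flip[of "flip k"] by simp
  next
    case (Cons l vs)
    define u where "u = foldr sl2 ws v"
    have IH: "sqnorm v < sqnorm u" "sqnorm (sl2 (flip l) u) < sqnorm u"
      using Cons.IH Cons.prems Cons reduced_ConsD by (auto simp: u_def)
    then have "u \<noteq> 0" by (auto simp: sqnorm_def) (metis add_nonneg_nonneg not_less zero_le_square)
    moreover have "k \<noteq> flip l" using Cons.prems Cons by auto
    ultimately have "sqnorm u < sqnorm (sl2 k u)"
      using sl2_expands[of u k "flip l"] IH by auto
    then show ?thesis
      using IH sl2_flip[of "flip k" u] by (simp add: u_def[symmetric])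
  qed
qed simp

text \<open>If the word fixes \<open>v\<close>, growth forbids its last letter to expand
  \<open>v\<close>, and growth for the inverse word forbids the same for the inverse of the head. By
  \<open>sl2_expands\<close> these two letters coincide, so the word is a conjugate of a shorter
  one, which fixes the image of \<open>v\<close> under that letter.\<close>

lemma sl2_no_fixed_vector:
  assumes "reduced ws" "ws \<noteq> []" "v \<noteq> 0"
  shows "foldr sl2 ws v \<noteq> v"
  using assms
proof (induction "length ws" arbitrary: ws v rule: less_induct)
  case less
  show ?case
  proof
    assume fixd: "foldr sl2 ws v = v"
    have inv: "foldr sl2 (inverse_word ws) v = v"
      using foldr_inverse_word(1)[of sl2 ws v, OF sl2_flip] fixd by simp
    have last: "\<not> sqnorm v < sqnorm (sl2 (last ws) v)"
      using sl2_growth[of ws v] less.prems fixd by auto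
    have "last (inverse_word ws) = flip (hd ws)" "inverse_word ws \<noteq> []"
      using less.prems by (auto simp: inverse_word_def last_rev hd_map)
    then have hd: "\<not> sqnorm v < sqnorm (sl2 (flip (hd ws)) v)"
      using sl2_growth[of "inverse_word ws" v] less.prems inv reduced_inverse_word by auto
    have eq: "flip (hd ws) = last ws"
      using sl2_expands[OF less.prems(3), of "flip (hd ws)" "last ws"] hd last by blast
    obtain k us where us: "ws = k # us" using less.prems by (cases ws) auto
    have "us \<noteq> []" using eq us by auto
    then obtain vs l where vs: "us = vs @ [l]" by (metis rev_exhaust)
    have k: "k = flip l" using eq us vs by (auto simp: flip_eq_iff)
    \<comment> \<open>Otherwise the word would be \<open>[flip l, l]\<close>, which is not
      reduced.\<close>
    have ne: "vs \<noteq> []" using less.prems(1) by (auto simp: us vs k)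
    have "reduced vs" using reduced_ConsD[of k "vs @ [l]"] less.prems(1) by (simp add: us vs reduced_append)
    moreover have "foldr sl2 vs (sl2 l v) = sl2 l v"
      using fixd sl2_flip[of l "foldr sl2 vs (sl2 l v)"] by (simp add: us vs k)
    moreover have "sl2 l v \<noteq> 0" using less.prems(3) by (simp add: sl2_zero_iff)
    ultimately show False using less.hyps[of vs "sl2 l v"] ne by (simp add: us vs)
  qed
qed


subsection \<open>A cyclic division algebra of degree 3\<close>

text \<open>\<open>Cubic a b c\<close> stands for \<open>a + b \<alpha> + c \<alpha>\<^sup>2\<close> where \<open>\<alpha>\<^sup>3 = 3 \<alpha> - 1\<close>; the Galois group of this
  cyclic cubic field is generated by \<open>\<alpha> \<mapsto> \<alpha>\<^sup>2 - 2\<close>.\<close>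

datatype cubic = Cubic int int int

instantiation cubic :: comm_ring_1
begin

definition zero_cubic :: cubic where "0 = Cubic 0 0 0"
definition one_cubic :: cubic where "1 = Cubic 1 0 0"

fun plus_cubic :: "cubic \<Rightarrow> cubic \<Rightarrow> cubic" where
  "Cubic a b c + Cubic a' b' c' = Cubic (a + a') (b + b') (c + c')"

fun uminus_cubic :: "cubic \<Rightarrow> cubic" where
  "- Cubic a b c = Cubic (- a) (- b) (- c)"

definition minus_cubic :: "cubic \<Rightarrow> cubic \<Rightarrow> cubic" where
  "x - y = x + - (y :: cubic)"

fun times_cubic :: "cubic \<Rightarrow> cubic \<Rightarrow> cubic" where
  "Cubic a b c * Cubic a' b' c' =
    Cubic (a * a' - (b * c' + c * b'))
      (a * b' + b * a' + 3 * (b * c' + c * b') - c * c')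
      (a * c' + b * b' + c * a' + 3 * (c * c'))"

instance
proof
  fix x y z :: cubic
  show "x * y * z = x * (y * z)"
    by (cases x; cases y; cases z) (simp add: algebra_simps)
  show "x * y = y * x"
    by (cases x; cases y) (simp add: algebra_simps)
  show "(x + y) * z = x * z + y * z"
    by (cases x; cases y; cases z) (simp add: algebra_simps)
  show "1 * x = x" by (cases x) (simp add: one_cubic_def)
  show "x + y + z = x + (y + z)" by (cases x; cases y; cases z) simp
  show "x + y = y + x" by (cases x; cases y) simp
  show "0 + x = x" by (cases x) (simp add: zero_cubic_def)
  show "- x + x = 0" by (cases x) (simp add: zero_cubic_def)
  show "x - y = x + - y" by (rule minus_cubic_def)
  show "(0 :: cubic) \<noteq> 1" by (simp add: zero_cubic_def one_cubic_def)
qed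

end

fun conj_cubic :: "cubic \<Rightarrow> cubic" where
  "conj_cubic (Cubic a b c) = Cubic (a - 2 * b + 4 * c) (- c) (b - c)"

lemma conj_cubic_hom [simp]:
  "conj_cubic (x + y) = conj_cubic x + conj_cubic y"
  "conj_cubic (x * y) = conj_cubic x * conj_cubic y"
  "conj_cubic 0 = 0" "conj_cubic 1 = 1"
  by (cases x; cases y; simp add: zero_cubic_def one_cubic_def algebra_simps)+

lemma conj_cubic_cubed [simp]: "conj_cubic (conj_cubic (conj_cubic x)) = x"
  by (cases x) simp

definition ev_cubic :: "real \<Rightarrow> cubic \<Rightarrow> real" where
  "ev_cubic t x = (case x of Cubic a b c \<Rightarrow> of_int a + of_int b * t + of_int c * t\<^sup>2)"

lemma ev_cubic_add: "ev_cubic t (x + y) = ev_cubic t x + ev_cubic t y"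
  by (cases x; cases y) (simp add: ev_cubic_def algebra_simps)

lemma ev_cubic_mult:
  assumes "t ^ 3 = 3 * t - 1"
  shows "ev_cubic t (x * y) = ev_cubic t x * ev_cubic t y"
proof -
  have t3: "t * (t * t) = 3 * t - 1" using assms by (simp add: power3_eq_cube)
  then have t4: "t * (t * (t * w)) = 3 * (t * w) - w" for w
    by (metis left_diff_distrib mult.assoc mult_1)
  show ?thesis
    by (cases x; cases y) (simp add: ev_cubic_def power2_eq_square algebra_simps t3 t4)
qed

lemma ev_cubic_conj:
  assumes "t ^ 3 = 3 * t - 1"
  shows "ev_cubic t (conj_cubic x) = ev_cubic (t\<^sup>2 - 2) x"
proof -
  have t3: "t * (t * t) = 3 * t - 1" using assms by (simp add: power3_eq_cube)
  then have t4: "t * (t * (t * w)) = 3 * (t * w) - w" for w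
    by (metis left_diff_distrib mult.assoc mult_1)
  show ?thesis
    by (cases x) (simp add: ev_cubic_def power2_eq_square algebra_simps t3 t4)
qed

text \<open>\<open>CycAlg x y z\<close> stands for \<open>x + y u + z u\<^sup>2\<close> in the cyclic algebra with
  \<open>u\<^sup>3 = 2\<close> and \<open>u x = conj_cubic x u\<close>.\<close>

datatype cycalg = CycAlg cubic cubic cubic

instantiation cycalg :: ring_1
begin

definition zero_cycalg :: cycalg where "0 = CycAlg 0 0 0"
definition one_cycalg :: cycalg where "1 = CycAlg 1 0 0"

fun plus_cycalg :: "cycalg \<Rightarrow> cycalg \<Rightarrow> cycalg" where
  "CycAlg x y z + CycAlg x' y' z' = CycAlg (x + x') (y + y') (z + z')"

fun uminus_cycalg :: "cycalg \<Rightarrow> cycalg" where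
  "- CycAlg x y z = CycAlg (- x) (- y) (- z)"

definition minus_cycalg :: "cycalg \<Rightarrow> cycalg \<Rightarrow> cycalg" where
  "v - w = v + - (w :: cycalg)"

fun times_cycalg :: "cycalg \<Rightarrow> cycalg \<Rightarrow> cycalg" where
  "CycAlg x y z * CycAlg x' y' z' = CycAlg
    (x * x' + 2 * (y * conj_cubic z' + z * conj_cubic (conj_cubic y')))
    (x * y' + y * conj_cubic x' + 2 * (z * conj_cubic (conj_cubic z')))
    (x * z' + y * conj_cubic y' + z * conj_cubic (conj_cubic x'))"

lemma conj_cubic_two [simp]: "conj_cubic 2 = 2"
  using conj_cubic_hom(1)[of 1 1] by simp

instance
proof
  fix x y z :: cycalg
  show "x * y * z = x * (y * z)"
    by (cases x; cases y; cases z) (simp add: algebra_simps)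
  show "(x + y) * z = x * z + y * z"
    by (cases x; cases y; cases z) (simp add: algebra_simps)
  show "x * (y + z) = x * y + x * z"
    by (cases x; cases y; cases z) (simp add: algebra_simps)
  show "1 * x = x" by (cases x) (simp add: one_cycalg_def)
  show "x * 1 = x" by (cases x) (simp add: one_cycalg_def)
  show "x + y + z = x + (y + z)" by (cases x; cases y; cases z) (simp add: add.assoc)
  show "x + y = y + x" by (cases x; cases y) (simp add: add.commute)
  show "0 + x = x" by (cases x) (simp add: zero_cycalg_def)
  show "- x + x = 0" by (cases x) (simp add: zero_cycalg_def)
  show "x - y = x + - y" by (rule minus_cycalg_def)
  show "(0 :: cycalg) \<noteq> 1" by (simp add: zero_cycalg_def one_cycalg_def)
qed

end

section \<open>Absence of zero divisors in the cyclic algebra\<close>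

fun even_cubic :: "cubic \<Rightarrow> bool" where
  "even_cubic (Cubic a b c) \<longleftrightarrow> even a \<and> even b \<and> even c"

lemma even_cubic_iff: "even_cubic x \<longleftrightarrow> (\<exists>y. x = y + y)"
proof
  assume "even_cubic x"
  then show "\<exists>y. x = y + y"
  proof (cases x)
    case (Cubic a b c)
    then have "x = Cubic (a div 2) (b div 2) (c div 2) + Cubic (a div 2) (b div 2) (c div 2)"
      using \<open>even_cubic x\<close> by simp
    then show ?thesis ..
  qed
next
  assume "\<exists>y. x = y + y"
  then obtain y where "x = y + y" ..
  then show "even_cubic x" by (cases y) simp
qed

lemma even_cubicE:
  assumes "even_cubic x"
  obtains y where "x = y + y"
  using assms even_cubic_iff by blast

lemma even_cubic_conj [simp]: "even_cubic (conj_cubic x) = even_cubic x"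
  by (cases x) auto

lemma even_cubic_add: "even_cubic x \<Longrightarrow> even_cubic (x + y) \<longleftrightarrow> even_cubic y"
  by (cases x; cases y) simp

lemma even_cubic_double [simp]: "even_cubic (2 * x)"
  unfolding even_cubic_iff mult_2 by blast

lemma even_cubic_zero [simp]: "even_cubic 0"
  by (simp add: zero_cubic_def)

text \<open>2 is inert in the cubic field, so the even elements form a prime ideal.\<close>

lemma even_cubic_mult [simp]: "even_cubic (x * y) \<longleftrightarrow> even_cubic x \<or> even_cubic y"
proof -
  obtain a b c where x: "x = Cubic a b c" by (cases x)
  obtain a' b' c' where y: "y = Cubic a' b' c'" by (cases y)
  show ?thesis
    unfolding x y times_cubic.simps even_cubic.simps
    by (cases "even a"; cases "even b"; cases "even c"; cases "even a'"; cases "even b'"; cases "even c'"; simp)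
qed

lemma double_cubic_eq_0: "2 * x = 0 \<Longrightarrow> x = (0 :: cubic)"
  unfolding mult_2 by (cases x) (simp add: zero_cubic_def)

fun even_cycalg :: "cycalg \<Rightarrow> bool" where
  "even_cycalg (CycAlg x y z) \<longleftrightarrow> even_cubic x \<and> even_cubic y \<and> even_cubic z"

text \<open>The product of two even elements is divisible by 4, hence so is
  \<open>2 * r\<close>.\<close>

lemma even_half:
  assumes "even_cubic x" "even_cubic y" "x * y + 2 * r = 0"
  shows "even_cubic r"
proof -
  obtain a where a: "x = a + a" using assms(1) by (rule even_cubicE)
  obtain b where b: "y = b + b" using assms(2) by (rule even_cubicE)
  have "2 * (2 * (a * b) + r) = 0" using assms(3) by (simp add: a b algebra_simps)
  then have "2 * (a * b) + r = 0" by (rule double_cubic_eq_0)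
  then show ?thesis by (metis even_cubic_add even_cubic_double even_cubic_zero)
qed

text \<open>The cases follow the \<open>u\<close>-adic valuation of \<open>w\<close>.\<close>

lemma zero_product_even:
  assumes "v * w = 0" "\<not> even_cycalg w"
  shows "even_cycalg v"
proof -
  obtain x y z where v: "v = CycAlg x y z" by (cases v)
  obtain x' y' z' where w: "w = CycAlg x' y' z'" by (cases w)
  let ?s = conj_cubic
  have eq: "x * x' + 2 * (y * ?s z' + z * ?s (?s y')) = 0"
    "x * y' + y * ?s x' + 2 * (z * ?s (?s z')) = 0"
    "x * z' + y * ?s y' + z * ?s (?s x') = 0"
    using assms(1) by (simp_all add: v w zero_cycalg_def)
  have p1: "even_cubic (x * x')" "even_cubic (x * y' + y * ?s x')"
    "even_cubic (x * z' + y * ?s y' + z * ?s (?s x'))"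
    using eq by (metis even_cubic_add even_cubic_double even_cubic_zero add.commute)+
  show ?thesis
  proof (cases "even_cubic x'")
    case False
    then have "even_cubic x" using p1(1) by simp
    moreover from this have "even_cubic y" using False p1(2) by (simp add: even_cubic_add)
    ultimately show ?thesis using False p1(3) by (simp add: v even_cubic_add)
  next
    case x': True
    have xy: "even_cubic (x * y')"
      using p1(2) x' by (metis add.commute even_cubic_add even_cubic_conj even_cubic_mult)
    have q: "even_cubic (x * z' + y * ?s y')"
      using p1(3) x' by (metis add.commute even_cubic_add even_cubic_conj even_cubic_mult)
    show ?thesis
    proof (cases "even_cubic y'")
      case False
      then have x: "even_cubic x" using xy by simp
      moreover from x have y: "even_cubic y" using q False by (simp add: even_cubic_add)
      have "even_cubic (y * ?s z' + z * ?s (?s y'))"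
        using x x' eq(1) by (rule even_half)
      then have "even_cubic z" using y False by (simp add: even_cubic_add)
      with x y show ?thesis by (simp add: v)
    next
      case y': True
      then have z': "\<not> even_cubic z'" using assms(2) x' by (simp add: w)
      have "even_cubic (x * z')"
        using q y' by (metis add.commute even_cubic_add even_cubic_conj even_cubic_mult)
      then have x: "even_cubic x" using z' by simp
      have "even_cubic (y * ?s z' + z * ?s (?s y'))"
        using x x' eq(1) by (rule even_half)
      then have "even_cubic (y * ?s z')"
        using y' by (metis add.commute even_cubic_add even_cubic_conj even_cubic_mult)
      then have y: "even_cubic y" using z' by simp
      \<comment> \<open>In the second equation the first two products are now divisible by 4, so
        after halving they are still even, and so is the remaining term.\<close>
      obtain a where a: "x = a + a" using x by (rule even_cubicE)
      obtain b where b: "y' = b + b" using y' by (rule even_cubicE)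
      obtain c where c: "y = c + c" using y by (rule even_cubicE)
      obtain d where d: "?s x' = d + d" using x' even_cubicE[of "?s x'"] by auto
      have "2 * (2 * (a * b + c * d) + z * ?s (?s z')) = 0"
        using eq(2) by (simp add: a b c d algebra_simps)
      then have "2 * (a * b + c * d) + z * ?s (?s z') = 0" by (rule double_cubic_eq_0)
      then have "even_cubic (z * ?s (?s z'))"
        by (metis even_cubic_add even_cubic_double even_cubic_zero)
      then have "even_cubic z" using z' by simp
      with x y show ?thesis by (simp add: v)
    qed
  qed
qed

fun abs_cubic :: "cubic \<Rightarrow> nat" where
  "abs_cubic (Cubic a b c) = nat \<bar>a\<bar> + nat \<bar>b\<bar> + nat \<bar>c\<bar>"

fun abs_cycalg :: "cycalg \<Rightarrow> nat" where
  "abs_cycalg (CycAlg x y z) = abs_cubic x + abs_cubic y + abs_cubic z"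

lemma abs_cubic_double: "abs_cubic (2 * x) = 2 * abs_cubic x"
  unfolding mult_2[of x] by (cases x) (simp add: nat_abs_mult_distrib)

lemma abs_cubic_eq_0: "abs_cubic x = 0 \<longleftrightarrow> x = 0"
  by (cases x) (auto simp: zero_cubic_def)

lemma even_cycalg_half:
  assumes "even_cycalg v" "v \<noteq> 0"
  obtains v' where "v = v' + v'" "abs_cycalg v' < abs_cycalg v"
proof -
  obtain x y z where v: "v = CycAlg x y z" by (cases v)
  obtain x' where x: "x = x' + x'" using assms(1) v even_cubicE[of x] by auto
  obtain y' where y: "y = y' + y'" using assms(1) v even_cubicE[of y] by auto
  obtain z' where z: "z = z' + z'" using assms(1) v even_cubicE[of z] by auto
  have "abs_cycalg v \<noteq> 0"
    using assms(2) by (auto simp: v zero_cycalg_def abs_cubic_eq_0)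
  then have "abs_cycalg (CycAlg x' y' z') < abs_cycalg v"
    by (auto simp: v x y z abs_cubic_double)
  then show thesis using that[of "CycAlg x' y' z'"] by (simp add: v x y z)
qed

lemma double_cycalg_eq_0: "v + v = 0 \<Longrightarrow> v = (0 :: cycalg)"
proof -
  assume eq: "v + v = 0"
  obtain x y z where v: "v = CycAlg x y z" by (cases v)
  have "x + x = 0" "y + y = 0" "z + z = 0"
    using eq unfolding v plus_cycalg.simps zero_cycalg_def by (simp_all only: cycalg.inject)
  then show ?thesis
    unfolding v zero_cycalg_def mult_2[symmetric] using double_cubic_eq_0 by blast
qed

text \<open>Infinite descent: a vanishing product has an even factor, which can be halved; for a
  nonzero factor this lowers the sum of the absolute values of its coefficients.\<close>

lemma cycalg_no_zero_divisors: "v * w = 0 \<Longrightarrow> v = 0 \<or> w = (0 :: cycalg)"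
proof (induction "abs_cycalg v + abs_cycalg w" arbitrary: v w rule: less_induct)
  case less
  show ?case
  proof (rule ccontr)
    assume nz: "\<not> (v = 0 \<or> w = 0)"
    show False
    proof (cases "even_cycalg w")
      case True
      then obtain w' where w': "w = w' + w'" "abs_cycalg w' < abs_cycalg w"
        using nz even_cycalg_half by metis
      have "v * w' = 0"
        using less.prems by (rule_tac double_cycalg_eq_0) (simp add: w'(1) distrib_left)
      with w'(2) have "v = 0 \<or> w' = 0" by (intro less.hyps) simp_all
      then show False using nz w'(1) by (metis add_0)
    next
      case False
      then obtain v' where v': "v = v' + v'" "abs_cycalg v' < abs_cycalg v"
        using nz even_cycalg_half zero_product_even[OF less.prems] by metis
      have "v' * w = 0"
        using less.prems by (rule_tac double_cycalg_eq_0) (simp add: v'(1) distrib_right)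
      with v'(2) have "v' = 0 \<or> w = 0" by (intro less.hyps) simp_all
      then show False using nz v'(1) by (metis add_0)
    qed
  qed
qed

subsection \<open>A free group of units\<close>

text \<open>\<open>gen\<close> is \<open>\<alpha>\<close>, and \<open>twist\<close> is \<open>(1 - u)\<^sup>2\<close>, a unit because \<open>(1 - u) (1 + u + u\<^sup>2) = - 1\<close>. What matters
  about \<open>twist\<close> is that it and its inverse have three nonzero coordinates.\<close>

definition gen :: cycalg where "gen = CycAlg (Cubic 0 1 0) 0 0"
definition gen_inv :: cycalg where "gen_inv = CycAlg (Cubic 3 0 (-1)) 0 0"
definition twist :: cycalg where "twist = CycAlg (Cubic 1 0 0) (Cubic (-2) 0 0) (Cubic 1 0 0)"
definition twist_inv :: cycalg where "twist_inv = CycAlg (Cubic 5 0 0) (Cubic 4 0 0) (Cubic 3 0 0)"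

lemma two_cubic: "(2 :: cubic) = Cubic 2 0 0"
  unfolding one_add_one[symmetric] by (simp add: one_cubic_def)

lemma gen_inverse: "gen * gen_inv = 1" "gen_inv * gen = 1"
  and twist_inverse: "twist * twist_inv = 1" "twist_inv * twist = 1"
  by (simp_all add: gen_def gen_inv_def twist_def twist_inv_def one_cycalg_def one_cubic_def
      zero_cubic_def two_cubic)

lemma three_cycalg: "(3 :: cycalg) = CycAlg (Cubic 3 0 0) 0 0"
proof -
  have "(1 + (1 + 1) :: cycalg) = CycAlg (Cubic 3 0 0) 0 0"
    unfolding one_cycalg_def by (simp add: one_cubic_def zero_cubic_def)
  then show ?thesis by simp
qed

text \<open>The minimal polynomial of \<alpha>. The integer stands on the right of
  \<open>gen\<close> because \<open>- 3\<close> will be the lattice vector on which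
  \<open>gen\<close> acts.\<close>

lemma gen_relation: "1 + gen * (- 3) + gen * gen * gen = 0"
  by (simp add: three_cycalg gen_def one_cycalg_def zero_cycalg_def one_cubic_def zero_cubic_def
      two_cubic)

text \<open>The exponent \<open>N\<close> makes the diagonal action contract strongly enough for
  ping-pong; conjugation by \<open>twist\<close> moves its attracting axes away from the coordinate
  planes.\<close>

fun unit_of :: "nat \<Rightarrow> letter \<Rightarrow> cycalg" where
  "unit_of N (x, s) = (if x then twist * (if s then gen else gen_inv) ^ N * twist_inv
     else (if s then gen else gen_inv) ^ N)"

lemma power_inverse:
  fixes a b :: "'a::monoid_mult"
  assumes "a * b = 1"
  shows "a ^ n * b ^ n = 1"
proof (induction n)
  case (Suc n)
  have "a ^ Suc n * b ^ Suc n = a ^ n * (a * b) * b ^ n"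
    by (simp add: power_Suc2[of a] mult.assoc del: power_Suc) (simp add: mult.assoc)
  then show ?case using Suc assms by simp
qed simp

lemma unit_of_flip: "unit_of N l * unit_of N (flip l) = 1"
proof -
  have "twist * a * twist_inv * (twist * b * twist_inv) = 1" if "a * b = 1" for a b
  proof -
    have "twist * a * twist_inv * (twist * b * twist_inv) =
        twist * a * (twist_inv * twist) * b * twist_inv" by (simp only: mult.assoc)
    also have "\<dots> = twist * (a * b) * twist_inv" by (simp add: twist_inverse mult.assoc)
    also have "\<dots> = 1" by (simp add: that twist_inverse)
    finally show ?thesis .
  qed
  then show ?thesis
    by (cases l) (simp add: power_inverse gen_inverse)
qed

text \<open>The \<open>t i\<close> are the three real conjugates of \<alpha> in Galois order. Their
  absolute values increase in the order 1, 0, 2, and \<open>N\<close> separates the powers.\<close>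

locale real_embedding =
  fixes t :: "nat \<Rightarrow> real" and N :: nat
  assumes root: "t i ^ 3 = 3 * t i - 1"
    and conj: "t 1 = (t 0)\<^sup>2 - 2" "t 2 = (t 1)\<^sup>2 - 2" "t 0 = (t 2)\<^sup>2 - 2"
    and gap: "400 * \<bar>t 1\<bar> ^ N \<le> \<bar>t 0\<bar> ^ N" "400 * \<bar>t 0\<bar> ^ N \<le> \<bar>t 2\<bar> ^ N"
begin

text \<open>The splitting of the algebra over the reals: elements of the cubic field act diagonally
  through their three real places, and \<open>u\<close> acts by
  \<open>(w0, w1, w2) \<mapsto> (w1, w2, 2 * w0)\<close>, whose cube is 2.\<close>

definition rep :: "cycalg \<Rightarrow> real \<times> real \<times> real \<Rightarrow> real \<times> real \<times> real" where
  "rep v w = (case v of CycAlg x y z \<Rightarrow> case w of (w0, w1, w2) \<Rightarrow>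
    (ev_cubic (t 0) x * w0 + ev_cubic (t 0) y * w1 + ev_cubic (t 0) z * w2,
     ev_cubic (t 1) x * w1 + ev_cubic (t 1) y * w2 + 2 * ev_cubic (t 1) z * w0,
     ev_cubic (t 2) x * w2 + 2 * ev_cubic (t 2) y * w0 + 2 * ev_cubic (t 2) z * w1))"

lemma ev_conj: "ev_cubic (t 0) (conj_cubic x) = ev_cubic (t 1) x"
  "ev_cubic (t 1) (conj_cubic x) = ev_cubic (t 2) x"
  "ev_cubic (t 2) (conj_cubic x) = ev_cubic (t 0) x"
  by (simp_all only: ev_cubic_conj[OF root] conj[symmetric])

lemma ev_two: "ev_cubic s 2 = 2"
  by (simp add: two_cubic ev_cubic_def)

lemma rep_mult: "rep (v * v') w = rep v (rep v' w)"
proof (cases v; cases v'; cases w)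
  fix x y z x' y' z' w0 w1 w2
  assume "v = CycAlg x y z" "v' = CycAlg x' y' z'" "w = (w0, w1, w2)"
  then show ?thesis
    by (simp add: rep_def ev_cubic_add ev_cubic_mult[OF root] ev_conj[unfolded One_nat_def] ev_two algebra_simps)
qed

lemma rep_one: "rep 1 w = w"
  by (cases w) (simp add: rep_def one_cycalg_def one_cubic_def zero_cubic_def ev_cubic_def)

lemma rep_gen_power: "rep (gen ^ n) (w0, w1, w2) = (t 0 ^ n * w0, t 1 ^ n * w1, t 2 ^ n * w2)"
proof (induction n)
  case (Suc n)
  then show ?case
    by (simp add: rep_mult) (simp add: rep_def gen_def zero_cubic_def ev_cubic_def)
qed (simp add: rep_one)

lemma t_nonzero: "t i \<noteq> 0"
  using root[of i] by auto

lemma rep_gen_inv_power: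
  "rep (gen_inv ^ n) (w0, w1, w2) = (w0 / t 0 ^ n, w1 / t 1 ^ n, w2 / t 2 ^ n)"
proof -
  have "rep (gen ^ n) (w0 / t 0 ^ n, w1 / t 1 ^ n, w2 / t 2 ^ n) = (w0, w1, w2)"
    by (simp add: rep_gen_power t_nonzero)
  then have "rep (gen_inv ^ n) (w0, w1, w2) =
      rep (gen_inv ^ n * gen ^ n) (w0 / t 0 ^ n, w1 / t 1 ^ n, w2 / t 2 ^ n)"
    by (simp add: rep_mult)
  then show ?thesis
    by (simp add: power_inverse gen_inverse rep_one)
qed

lemma rep_twist: "rep twist (w0, w1, w2) =
    (w0 - 2 * w1 + w2, w1 - 2 * w2 + 2 * w0, w2 - 4 * w0 + 2 * w1)"
  and rep_twist_inv: "rep twist_inv (w0, w1, w2) =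
    (5 * w0 + 4 * w1 + 3 * w2, 5 * w1 + 4 * w2 + 6 * w0, 5 * w2 + 8 * w0 + 6 * w1)"
  by (simp_all add: rep_def twist_def twist_inv_def ev_cubic_def)

text \<open>Cones around the axes of the largest and of the smallest conjugate, to which high powers
  of \<open>gen\<close> and of \<open>gen_inv\<close> respectively attract.\<close>

fun attracting :: "bool \<Rightarrow> (real \<times> real \<times> real) set" where
  "attracting True = {(w0, w1, w2). 50 * \<bar>w0\<bar> \<le> \<bar>w2\<bar> \<and> 50 * \<bar>w1\<bar> \<le> \<bar>w2\<bar> \<and> w2 \<noteq> 0}"
| "attracting False = {(w0, w1, w2). 50 * \<bar>w0\<bar> \<le> \<bar>w1\<bar> \<and> 50 * \<bar>w2\<bar> \<le> \<bar>w1\<bar> \<and> w1 \<noteq> 0}"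

definition spread :: "(real \<times> real \<times> real) set" where
  "spread = {(w0, w1, w2). w0 \<noteq> 0 \<and> w1 \<noteq> 0 \<and> w2 \<noteq> 0 \<and> \<bar>w1\<bar> \<le> 8 * \<bar>w0\<bar> \<and>
     \<bar>w2\<bar> \<le> 8 * \<bar>w0\<bar> \<and> \<bar>w0\<bar> \<le> 8 * \<bar>w1\<bar> \<and> \<bar>w2\<bar> \<le> 8 * \<bar>w1\<bar> \<and> \<bar>w0\<bar> \<le> 8 * \<bar>w2\<bar> \<and> \<bar>w1\<bar> \<le> 8 * \<bar>w2\<bar>}"

text \<open>The two bounds have quotient 8, the constant in \<open>spread\<close>. Up to sign and a
  scale, \<open>twist\<close> sends the two axes to (1,-2,1) and (-2,1,2), and
  \<open>twist_inv\<close> sends them to (3,4,5) and (4,5,6); the bounds leave room for coordinate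
  errors of relative size 1/50.\<close>

lemma spreadI:
  assumes "0 < m" "\<And>x. x \<in> {w0, w1, w2} \<Longrightarrow> 18/25 * m \<le> \<bar>x\<bar> \<and> \<bar>x\<bar> \<le> 144/25 * m"
  shows "(w0, w1, w2) \<in> spread"
  using assms(1) assms(2)[of w0] assms(2)[of w1] assms(2)[of w2]
  unfolding spread_def by auto

lemma attracting_twist:
  assumes "w \<in> attracting s"
  shows "rep twist w \<in> spread"
proof -
  obtain w0 w1 w2 where w: "w = (w0, w1, w2)" by (cases w)
  show ?thesis
  proof (cases s)
    case True
    then have c: "50 * \<bar>w0\<bar> \<le> \<bar>w2\<bar>" "50 * \<bar>w1\<bar> \<le> \<bar>w2\<bar>" "w2 \<noteq> 0" using assms w by auto
    show ?thesis unfolding w rep_twist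
    proof (rule spreadI)
      show "0 < \<bar>w2\<bar>" using c by simp
    qed (use c in \<open>auto simp: abs_if split: if_splits\<close>)
  next
    case False
    then have c: "50 * \<bar>w0\<bar> \<le> \<bar>w1\<bar>" "50 * \<bar>w2\<bar> \<le> \<bar>w1\<bar>" "w1 \<noteq> 0" using assms w by auto
    show ?thesis unfolding w rep_twist
    proof (rule spreadI)
      show "0 < \<bar>w1\<bar>" using c by simp
    qed (use c in \<open>auto simp: abs_if split: if_splits\<close>)
  qed
qed

lemma attracting_twist_inv:
  assumes "w \<in> attracting s"
  shows "rep twist_inv w \<in> spread"
proof -
  obtain w0 w1 w2 where w: "w = (w0, w1, w2)" by (cases w)
  show ?thesis
  proof (cases s)
    case True
    then have c: "50 * \<bar>w0\<bar> \<le> \<bar>w2\<bar>" "50 * \<bar>w1\<bar> \<le> \<bar>w2\<bar>" "w2 \<noteq> 0" using assms w by auto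
    show ?thesis unfolding w rep_twist_inv
    proof (rule spreadI)
      show "0 < \<bar>w2\<bar>" using c by simp
    qed (use c in \<open>auto simp: abs_if split: if_splits\<close>)
  next
    case False
    then have c: "50 * \<bar>w0\<bar> \<le> \<bar>w1\<bar>" "50 * \<bar>w2\<bar> \<le> \<bar>w1\<bar>" "w1 \<noteq> 0" using assms w by auto
    show ?thesis unfolding w rep_twist_inv
    proof (rule spreadI)
      \<comment> \<open>The image is close to a multiple of (4,5,6), whose last entry exceeds
        144/25; the factor 4/3 shifts the interval to cover it.\<close>
      show "0 < \<bar>4/3 * w1\<bar>" using c by simp
    qed (use c in \<open>auto simp: abs_if split: if_splits\<close>)
  qed
qed

definition diag :: "bool \<Rightarrow> cycalg" where
  "diag s = (if s then gen else gen_inv) ^ N"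

lemma gap_mono: "400 * \<bar>t 1\<bar> ^ N \<le> \<bar>t 2\<bar> ^ N"
proof -
  have "0 \<le> \<bar>t 0\<bar> ^ N" by simp
  then show ?thesis using gap by linarith
qed

text \<open>The factor 400 in the gap is 50 times 8: it turns the comparability by 8 in
  \<open>spread\<close> into the dominance by 50 in \<open>attracting\<close>.\<close>

lemma contract:
  fixes a b p q :: real
  assumes "400 * p \<le> q" "0 < p" "\<bar>a\<bar> \<le> 8 * \<bar>b\<bar>"
  shows "50 * (p * \<bar>a\<bar>) \<le> q * \<bar>b\<bar>" "50 * (\<bar>a\<bar> / q) \<le> \<bar>b\<bar> / p"
proof -
  have "50 * (p * \<bar>a\<bar>) \<le> 50 * (p * (8 * \<bar>b\<bar>))"
    using assms by (intro mult_left_mono) auto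
  also have "\<dots> = (400 * p) * \<bar>b\<bar>" by simp
  also have "\<dots> \<le> q * \<bar>b\<bar>" using assms by (intro mult_right_mono) auto
  finally show *: "50 * (p * \<bar>a\<bar>) \<le> q * \<bar>b\<bar>" .
  have "0 < q" using assms by simp
  then show "50 * (\<bar>a\<bar> / q) \<le> \<bar>b\<bar> / p"
    using * assms(2) by (simp add: field_simps)
qed

lemma diag_attracting:
  assumes "w \<in> spread \<or> w \<in> attracting s"
  shows "rep (diag s) w \<in> attracting s"
proof -
  obtain w0 w1 w2 where w: "w = (w0, w1, w2)" by (cases w)
  have p: "0 < \<bar>t i\<bar> ^ N" for i using t_nonzero by simp
  show ?thesis
  proof (cases s)
    case True
    then have c: "\<bar>w0\<bar> \<le> 8 * \<bar>w2\<bar>" "\<bar>w1\<bar> \<le> 8 * \<bar>w2\<bar>" "w2 \<noteq> 0"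
      using assms by (auto simp: w spread_def)
    show ?thesis
      using contract(1)[OF gap(2) p c(1)] contract(1)[OF gap_mono p c(2)] c(3)
      by (simp add: True w diag_def rep_gen_power abs_mult power_abs t_nonzero)
  next
    case False
    then have c: "\<bar>w0\<bar> \<le> 8 * \<bar>w1\<bar>" "\<bar>w2\<bar> \<le> 8 * \<bar>w1\<bar>" "w1 \<noteq> 0"
      using assms by (auto simp: w spread_def)
    show ?thesis
      using contract(2)[OF gap(1) p c(1)] contract(2)[OF gap_mono p c(2)] c(3)
      by (simp add: False w diag_def rep_gen_inv_power abs_mult power_abs t_nonzero)
  qed
qed

lemma attracting_disjoint:
  "attracting True \<inter> attracting False = {}" "attracting s \<inter> spread = {}"
  by (auto simp: spread_def) (cases s; auto)+

fun ping_set :: "letter \<Rightarrow> (real \<times> real \<times> real) set" where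
  "ping_set (x, s) = (if x then {w. rep twist_inv w \<in> attracting s} else attracting s)"

lemma twisted_spread: "rep twist_inv w \<in> attracting s \<Longrightarrow> w \<in> spread"
  using attracting_twist[of "rep twist_inv w" s]
  by (simp add: twist_inverse rep_one flip: rep_mult)

text \<open>Ping-pong with the two cones and their images under \<open>twist\<close>. The images lie
  in \<open>spread\<close>, hence are disjoint from the cones, and each diagonal power sends all of
  \<open>spread\<close> into its own cone. For a conjugated letter the same is applied after
  \<open>twist_inv\<close>.\<close>

lemma unit_of_free:
  assumes "reduced ws" "ws \<noteq> []"
  shows "foldr (\<lambda>l v. unit_of N l * v) ws 1 \<noteq> 1"
proof
  assume one: "foldr (\<lambda>l v. unit_of N l * v) ws 1 = 1"
  let ?\<phi> = "\<lambda>l. rep (unit_of N l)"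
  have fold: "foldr ?\<phi> us w = rep (foldr (\<lambda>l v. unit_of N l * v) us 1) w" for us w
    by (induction us) (simp_all add: rep_one rep_mult)
  have "foldr ?\<phi> ws \<noteq> id"
  proof (rule ping_pong[OF assms, where X = ping_set])
    fix k l w assume kl: "k \<noteq> flip l" and w: "w \<in> ping_set l"
    obtain x s y r where xs: "k = (x, s)" "l = (y, r)" by (cases k; cases l)
    have unit: "unit_of N (x, s) = (if x then twist * diag s * twist_inv else diag s)"
      by (simp add: diag_def)
    show "rep (unit_of N k) w \<in> ping_set k"
    proof (cases x)
      case x: True
      have "rep twist_inv (rep (unit_of N k) w) =
          rep (twist_inv * twist * diag s * twist_inv) w"
        unfolding xs unit by (simp add: x rep_mult mult.assoc)
      also have "\<dots> = rep (diag s) (rep twist_inv w)"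
        by (simp add: twist_inverse rep_mult)
      finally have *: "rep twist_inv (rep (unit_of N k) w) = rep (diag s) (rep twist_inv w)" .
      have "rep twist_inv w \<in> spread \<or> rep twist_inv w \<in> attracting s"
      proof (cases y)
        case True
        then have "s = r" using kl xs x by auto
        then show ?thesis using w True xs by simp
      next
        case False
        then show ?thesis using w xs attracting_twist_inv by auto
      qed
      from diag_attracting[OF this] show ?thesis using * x xs by simp
    next
      case x: False
      have "w \<in> spread \<or> w \<in> attracting s"
      proof (cases y)
        case True
        then show ?thesis using w xs twisted_spread by auto
      next
        case False
        then have "s = r" using kl xs x by auto
        then show ?thesis using w False xs by simp
      qed
      from diag_attracting[OF this] show ?thesis unfolding xs unit using x by simp
    qed
  next
    fix k l :: letter assume "k \<noteq> l"
    obtain x s y r where xs: "k = (x, s)" "l = (y, r)" by (cases k; cases l)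
    have same: "s = r" if "w \<in> attracting s" "w \<in> attracting r" for w
    proof (rule ccontr)
      assume "s \<noteq> r"
      then have "w \<in> attracting True \<inter> attracting False" using that by (cases s; cases r) simp_all
      then show False unfolding attracting_disjoint(1) by simp
    qed
    show "ping_set k \<inter> ping_set l = {}"
    proof (rule equals0I)
      fix w assume w: "w \<in> ping_set k \<inter> ping_set l"
      have 1: "rep twist_inv w \<in> attracting s \<and> w \<in> spread" if x using w that xs twisted_spread[of w s] by auto
      have 2: "rep twist_inv w \<in> attracting r \<and> w \<in> spread" if y using w that xs twisted_spread[of w r] by auto
      have 3: "w \<in> attracting s" if "\<not> x" using w that xs by auto
      have 4: "w \<in> attracting r" if "\<not> y" using w that xs by auto
      have 5: "w \<notin> spread" if "w \<in> attracting q" for q using that attracting_disjoint(2) by blast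
      show False
      proof (cases "x = y")
        case True
        then have "s \<noteq> r" using \<open>k \<noteq> l\<close> xs by simp
        then show False using 1 2 3 4 same True by (cases x) blast+
      next
        case False
        then show False using 1 2 3 4 5 by (cases x) blast+
      qed
    qed
  next
    fix l :: letter
    obtain x s where l: "l = (x, s)" by (cases l)
    define w where "w = (0 :: real, if s then 0 else 1 :: real, if s then 1 else 0 :: real)"
    have w: "w \<in> attracting s" by (cases s) (auto simp: w_def)
    then have "w \<in> ping_set l \<or> rep twist w \<in> ping_set l"
      by (simp add: l twist_inverse rep_one flip: rep_mult)
    then show "ping_set l \<noteq> {}" by blast
  qed
  then show False by (simp add: fold one rep_one fun_eq_iff)
qed

end

lemma exists_real_embedding: "\<exists>t N. real_embedding t N"
proof -
  \<comment> \<open>The roots are 2 cos(2 pi k/9) for k = 1, 2, 4, called \<open>a\<close>,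
    \<open>b\<close>, \<open>c\<close>; the map \<open>x\<^sup>2 - 2\<close> doubles the
    angle.\<close>
  obtain a :: real where a: "3/2 \<le> a" "a \<le> 8/5" "a ^ 3 - 3 * a + 1 = 0"
  proof -
    have "\<exists>x\<ge>3/2. x \<le> 8/5 \<and> x ^ 3 - 3 * x + 1 = (0 :: real)"
      by (rule IVT') (auto simp: power3_eq_cube intro!: continuous_intros)
    then show thesis using that by blast
  qed
  define b where "b = a\<^sup>2 - 2"
  define c where "c = b\<^sup>2 - 2"
  have next_root: "(x\<^sup>2 - 2) ^ 3 = 3 * (x\<^sup>2 - 2) - 1" if "x ^ 3 = 3 * x - 1" for x :: real
  proof -
    have "x ^ 3 - (3 * x - 1) = 0" using that by simp
    \<comment> \<open>With p(x) = \<open>x ^ 3 - 3 * x + 1\<close>, this is the factorization of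
      p(\<open>x\<^sup>2 - 2\<close>) as - p(x) p(-x).\<close>
    moreover have "(x\<^sup>2 - 2) ^ 3 - (3 * (x\<^sup>2 - 2) - 1) =
        (x ^ 3 - (3 * x - 1)) * (x ^ 3 - 3 * x - 1)"
      by (simp add: power2_eq_square power3_eq_cube algebra_simps)
    ultimately show ?thesis by simp
  qed
  have ra: "a ^ 3 = 3 * a - 1" using a(3) by simp
  have rb: "b ^ 3 = 3 * b - 1" unfolding b_def by (rule next_root[OF ra])
  have rc: "c ^ 3 = 3 * c - 1" unfolding c_def by (rule next_root[OF rb])
  have a3: "a * (a * a) = 3 * a - 1" using ra by (simp add: power3_eq_cube)
  have a4: "a * (a * (a * a)) = 3 * (a * a) - a" unfolding a3 by (simp add: algebra_simps)
  have "c = 2 - a - a\<^sup>2" "(2 - a - a\<^sup>2)\<^sup>2 - 2 = a"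
    by (simp_all add: c_def b_def power2_eq_square algebra_simps a3 a4)
  then have ca: "c\<^sup>2 - 2 = a" by simp
  have "(3/2)\<^sup>2 \<le> a\<^sup>2" "a\<^sup>2 \<le> (8/5)\<^sup>2" using a by (auto intro!: power_mono)
  then have b: "1/4 \<le> b" "b \<le> 14/25" by (auto simp: b_def power2_eq_square)
  then have "b\<^sup>2 \<le> (14/25)\<^sup>2" by (intro power_mono) auto
  \<comment> \<open>The margin is narrow: the square of 14/25 minus 2 is -1.6864, while the
    right-hand side is about -1.684. The value 19/20 is a ratio that serves both pairs of
    neighbouring conjugates.\<close>
  then have c: "c \<le> - (8/5) / (19/20)" by (simp add: c_def power2_eq_square)
  have ratio: "\<bar>b\<bar> \<le> 19/20 * \<bar>a\<bar>" "\<bar>a\<bar> \<le> 19/20 * \<bar>c\<bar>"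
    using a b c by auto
  obtain N where N: "(19/20 :: real) ^ N < 1/400"
    using real_arch_pow_inv[of "1/400" "19/20"] by auto
  have gap: "400 * \<bar>x\<bar> ^ N \<le> \<bar>y\<bar> ^ N" if "\<bar>x\<bar> \<le> 19/20 * \<bar>y\<bar>" for x y :: real
  proof -
    have "\<bar>x\<bar> ^ N \<le> (19/20 * \<bar>y\<bar>) ^ N" using that by (intro power_mono) auto
    also have "\<dots> = (19/20) ^ N * \<bar>y\<bar> ^ N" by (rule power_mult_distrib)
    also have "\<dots> \<le> 1/400 * \<bar>y\<bar> ^ N" using N by (intro mult_right_mono) auto
    finally show ?thesis by simp
  qed
  define t where "t i = (if i = 0 then a else if i = 1 then b else c)" for i :: nat
  have "real_embedding t N"
    by unfold_locales (auto simp: t_def ra rb rc ca gap[OF ratio(1)] gap[OF ratio(2)] b_def[symmetric] c_def[symmetric])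
  then show ?thesis by blast
qed

subsection \<open>Lattices built from the order and from pairs of integers\<close>

fun coords :: "cycalg \<Rightarrow> int list" where
  "coords (CycAlg (Cubic a b c) (Cubic a' b' c') (Cubic a'' b'' c'')) = [a, b, c, a', b', c', a'', b'', c'']"

definition of_coords :: "(nat \<Rightarrow> int) \<Rightarrow> cycalg" where
  "of_coords g = CycAlg (Cubic (g 0) (g 1) (g 2)) (Cubic (g 3) (g 4) (g 5)) (Cubic (g 6) (g 7) (g 8))"

lemma of_coords_nth: "of_coords (\<lambda>j. coords v ! j) = v"
proof (cases v)
  case (CycAlg x y z)
  then show ?thesis by (cases x; cases y; cases z) (simp add: of_coords_def)
qed

lemma of_coords_add: "of_coords (\<lambda>j. f j + g j) = of_coords f + of_coords g"
  by (simp add: of_coords_def)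

lemma of_coords_inj:
  assumes "of_coords f = of_coords g" "j < 9"
  shows "f j = g j"
proof -
  have "j \<in> {0, 1, 2, 3, 4, 5, 6, 7, 8}" using assms(2) by auto
  then show ?thesis using assms(1) by (auto simp: of_coords_def)
qed

lemma of_coords_cong: "(\<And>j. j < 9 \<Longrightarrow> f j = g j) \<Longrightarrow> of_coords f = of_coords g"
  by (simp add: of_coords_def)

text \<open>A vector of length \<open>m + 2 k\<close>, where \<open>m\<close> is 0 or 9, is read as an element of the
  order followed by \<open>k\<close> pairs.\<close>

definition split_vec :: "nat \<Rightarrow> (nat \<Rightarrow> int) \<Rightarrow> cycalg \<times> (nat \<Rightarrow> int \<times> int)" where
  "split_vec m g = (of_coords (\<lambda>j. if j < m then g j else 0), \<lambda>p. (g (m + 2 * p), g (m + 2 * p + 1)))"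

lemma split_vec_add: "split_vec m (\<lambda>j. f j + g j) = split_vec m f + split_vec m g"
  by (simp add: split_vec_def of_coords_add[symmetric] plus_fun_def cong: if_cong)
    (rule of_coords_cong, simp)

lemma split_vec_inj:
  assumes "split_vec m f = split_vec m g" "m \<le> 9"
  shows "f j = g j"
proof (cases "j < m")
  case True
  then show ?thesis
    using of_coords_inj[of "\<lambda>j. if j < m then f j else 0" "\<lambda>j. if j < m then g j else 0" j] assms
    by (simp add: split_vec_def)
next
  case False
  define p where "p = (j - m) div 2"
  have "j = m + 2 * p \<or> j = m + 2 * p + 1" using False unfolding p_def by presburger
  moreover have "f (m + 2 * p) = g (m + 2 * p)" "f (m + 2 * p + 1) = g (m + 2 * p + 1)"
    using assms(1) by (auto simp: split_vec_def fun_eq_iff)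
  ultimately show ?thesis by auto
qed

lemma split_vec_surj:
  assumes m: "m = 0 \<and> fst x = 0 \<or> m = 9" and k: "\<And>p. k \<le> p \<Longrightarrow> snd x p = 0"
  shows "\<exists>g. split_vec m g = x \<and> (\<forall>j. m + 2 * k \<le> j \<longrightarrow> g j = 0)"
proof -
  define g where "g j = (if j < m then coords (fst x) ! j
    else if even (j - m) then fst (snd x ((j - m) div 2)) else snd (snd x ((j - m) div 2)))" for j
  have "of_coords (\<lambda>j. if j < m then g j else 0) = fst x"
  proof (cases "m = 9")
    case True
    then have "of_coords (\<lambda>j. if j < m then g j else 0) = of_coords (\<lambda>j. coords (fst x) ! j)"
      by (intro of_coords_cong) (simp add: g_def)
    then show ?thesis by (simp only: of_coords_nth)
  next
    case False
    then show ?thesis using m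
      by (simp add: of_coords_def zero_cycalg_def zero_cubic_def)
  qed
  moreover have "g (m + 2 * p) = fst (snd x p)" "g (m + 2 * p + 1) = snd (snd x p)" for p
    by (simp_all add: g_def)
  ultimately have "split_vec m g = x"
    by (simp add: split_vec_def prod_eq_iff)
  moreover have "g j = 0" if "m + 2 * k \<le> j" for j
  proof -
    have "k \<le> (j - m) div 2" using that by simp
    then show ?thesis using k that by (simp add: g_def)
  qed
  ultimately show ?thesis by blast
qed

section \<open>The free group acting on the order and on the pairs\<close>

definition act :: "nat \<Rightarrow> letter \<Rightarrow> cycalg \<times> (nat \<Rightarrow> int \<times> int) \<Rightarrow> cycalg \<times> (nat \<Rightarrow> int \<times> int)" where
  "act N l x = (unit_of N l * fst x, \<lambda>p. sl2 l (snd x p))"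

lemma act_flip: "act N l (act N (flip l) x) = x"
  by (simp add: act_def sl2_flip unit_of_flip flip: mult.assoc)

lemma act_add: "act N l (x + y) = act N l x + act N l y"
  by (simp add: act_def distrib_left sl2_add plus_fun_def)

lemma foldr_act_add: "foldr (act N) ws (x + y) = foldr (act N) ws x + foldr (act N) ws y"
  by (induction ws) (simp_all add: act_add)

lemma foldr_act: "foldr (act N) ws x =
    (foldr (\<lambda>l v. unit_of N l * v) ws 1 * fst x, \<lambda>p. foldr sl2 ws (snd x p))"
  by (induction ws) (simp_all add: act_def mult.assoc)

lemma foldr_sl2_zero: "foldr sl2 ws 0 = 0"
  by (induction ws) (simp_all add: sl2_zero_iff)

text \<open>A fixed vector has no nonzero pair, by the result on matrices. Its component in the
  algebra is then nonzero and annihilated by \<open>u - 1\<close>, where \<open>u\<close> is the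
  unit of the word; without zero divisors \<open>u = 1\<close>, against freeness of the
  units.\<close>

lemma foldr_act_no_fixed:
  assumes "real_embedding t N" "reduced ws" "ws \<noteq> []" "x \<noteq> 0"
  shows "foldr (act N) ws x \<noteq> x"
proof
  assume fixd: "foldr (act N) ws x = x"
  have "snd x p = 0" for p
  proof (rule ccontr)
    assume "snd x p \<noteq> 0"
    moreover have "foldr sl2 ws (snd x p) = snd x p"
      using fixd by (metis foldr_act snd_conv)
    ultimately show False using sl2_no_fixed_vector assms by blast
  qed
  then have "fst x \<noteq> 0" using assms(4) by (auto simp: prod_eq_iff zero_fun_def)
  moreover define u where "u = foldr (\<lambda>l v. unit_of N l * v) ws 1"
  moreover have "u * fst x = fst x" using fixd by (metis foldr_act fst_conv u_def)
  then have "(u - 1) * fst x = 0" by (simp add: left_diff_distrib)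
  ultimately have "u = 1" using cycalg_no_zero_divisors by force
  then show False
    using real_embedding.unit_of_free[OF assms(1-3)] by (simp add: u_def)
qed

lemma foldr_replicate: "foldr \<phi> (replicate n l) = \<phi> l ^^ n"
  by (induction n) auto

text \<open>A vector \<open>y\<close> on which the two orders of application agree yields a common
  image \<open>x\<close> fixed by the commutator word.\<close>

lemma act_powers_not_commuting:
  assumes "real_embedding t N" "1 \<le> n" "1 \<le> m" "x \<noteq> 0"
    and inv: "x = (act N (False, True) ^^ n) ((act N (True, True) ^^ m) y)"
      "x = (act N (True, True) ^^ m) ((act N (False, True) ^^ n) y)"
  shows False
proof -
  have c: "(act N l ^^ n) ((act N (flip l) ^^ n) z) = z" for l n z
    by (induction n arbitrary: z) (simp_all add: funpow_swap1 act_flip)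
  have c1: "(act N (False, False) ^^ n) ((act N (False, True) ^^ n) z) = z"
    and c2: "(act N (True, False) ^^ m) ((act N (True, True) ^^ m) z) = z" for z
    using c[of n "(False, False)"] c[of m "(True, False)"] by simp_all
  have "foldr (act N) (commutator_word n m) x = x"
    by (subst inv(2)) (simp only: foldr_commutator_word c1 c2 inv(1))
  then show False
    using foldr_act_no_fixed[OF assms(1)] reduced_commutator_word[OF assms(2,3)] assms(4) by blast
qed

text \<open>The matrix of the first generator has trace 6 and determinant 1.\<close>

lemma sl2_relation:
  "v + sl2 (False, True) (- (w + w)) + sl2 (False, True) (sl2 (False, True) v) = 0" if "w = v + v + v"
  by (cases v) (auto simp: that zero_prod_def)

lemma exists_coordinates:
  assumes card: "CARD('n::finite) = m + 2 * k" and m: "m = 0 \<or> m = 9"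
  obtains \<psi> :: "int ^ 'n \<Rightarrow> cycalg \<times> (nat \<Rightarrow> int \<times> int)"
  where "\<And>v w. \<psi> (v + w) = \<psi> v + \<psi> w" "inj \<psi>"
    "range \<psi> = {x. (m = 0 \<longrightarrow> fst x = 0) \<and> (\<forall>p\<ge>k. snd x p = 0)}"
proof -
  obtain e :: "'n \<Rightarrow> nat" where e: "bij_betw e UNIV {..<m + 2 * k}"
    using ex_bij_betw_finite_nat[of "UNIV :: 'n set"] card by (auto simp: atLeast0LessThan)
  define \<iota> where "\<iota> = inv_into UNIV e"
  have \<iota>: "\<iota> (e i) = i" "e i < m + 2 * k" for i
    using e by (auto simp: \<iota>_def bij_betw_def)
  have \<iota>2: "e (\<iota> j) = j" if "j < m + 2 * k" for j
    using e that by (auto simp: \<iota>_def bij_betw_def intro!: f_inv_into_f)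
  define c where "c v j = (if j < m + 2 * k then v $ \<iota> j else 0)" for v :: "int ^ 'n" and j
  have c_inj: "v = w" if "c v = c w" for v w
    using fun_cong[OF that, of "e i" for i] by (simp add: c_def \<iota> vec_eq_iff)
  show thesis
  proof (rule that[of "\<lambda>v. split_vec m (c v)"])
    have "c (v + w) = (\<lambda>j. c v j + c w j)" for v w by (auto simp: c_def)
    then show "split_vec m (c (v + w)) = split_vec m (c v) + split_vec m (c w)" for v w
      by (simp add: split_vec_add)
    show "inj (\<lambda>v. split_vec m (c v))"
      using m by (intro injI c_inj ext split_vec_inj) auto
    show "range (\<lambda>v. split_vec m (c v)) = {x. (m = 0 \<longrightarrow> fst x = 0) \<and> (\<forall>p\<ge>k. snd x p = 0)}"
    proof (intro equalityI subsetI)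
      fix x assume "x \<in> range (\<lambda>v. split_vec m (c v))"
      then show "x \<in> {x. (m = 0 \<longrightarrow> fst x = 0) \<and> (\<forall>p\<ge>k. snd x p = 0)}"
        by (auto simp: split_vec_def c_def of_coords_def zero_cycalg_def zero_cubic_def zero_prod_def)
    next
      fix x :: "cycalg \<times> (nat \<Rightarrow> int \<times> int)"
      assume x: "x \<in> {x. (m = 0 \<longrightarrow> fst x = 0) \<and> (\<forall>p\<ge>k. snd x p = 0)}"
      obtain g where g: "split_vec m g = x" "\<forall>j. m + 2 * k \<le> j \<longrightarrow> g j = 0"
        using split_vec_surj[of m x k] x m by auto
      have "c (\<chi> i. g (e i)) = g"
        using g(2) by (auto simp: c_def \<iota>2 fun_eq_iff)
      then show "x \<in> range (\<lambda>v. split_vec m (c v))"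
        using g(1) by (intro image_eqI[of _ _ "\<chi> i. g (e i)"]) simp_all
    qed
  qed
qed

lemma funpow_act_inverse:
  "(act N l ^^ j) ((act N (flip l) ^^ j) x) = x"
  by (induction j arbitrary: x) (simp_all add: funpow_swap1 act_flip)

text \<open>The relation is the Cayley-Hamilton identity on a vector \<open>a\<close> supported in
  the pair of index 0, which exists since \<open>1 \<le> k\<close>; the vector \<open>b\<close> is
  minus six times \<open>a\<close>, from the trace 6. The component of \<open>a\<close> in the order
  is 0, so the units contribute nothing to the relation.\<close>

lemma words_witness:
  assumes card: "CARD('n::finite) = m + 2 * k" and m: "m = 0 \<or> m = 9" and k: "1 \<le> k"
  shows "\<exists>\<Gamma>. subgroup \<Gamma> (torus_Aut :: ('n torus \<Rightarrow> 'n torus) monoid) \<and>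
           \<not> virtually_abelian ((torus_Aut :: ('n torus \<Rightarrow> 'n torus) monoid)\<lparr>carrier := \<Gamma>\<rparr>) \<and>
           mixing torus_measure \<Gamma> \<and>
           \<not> mixing_of_order 3 torus_measure \<Gamma>"
proof -
  obtain t N where emb: "real_embedding t N" using exists_real_embedding by blast
  obtain \<psi> :: "int ^ 'n \<Rightarrow> cycalg \<times> (nat \<Rightarrow> int \<times> int)"
    where \<psi>: "\<And>v w. \<psi> (v + w) = \<psi> v + \<psi> w" "inj \<psi>"
      and range: "range \<psi> = {x. (m = 0 \<longrightarrow> fst x = 0) \<and> (\<forall>p\<ge>k. snd x p = 0)}"
    by (rule exists_coordinates[OF card m], rule that; blast)
  have \<psi>_nz: "\<psi> v \<noteq> 0" if "v \<noteq> 0" for v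
  proof -
    have "\<psi> 0 = 0" using \<psi>(1)[of 0 0] by simp
    then show ?thesis using that \<psi>(2) by (metis injD)
  qed
  let ?S = "range (\<lambda>ws. foldr (act N) ws)"
  define a :: "cycalg \<times> (nat \<Rightarrow> int \<times> int)" where "a = (0, \<lambda>p. if p = 0 then (1, 0) else 0)"
  have a_range: "a \<in> range \<psi>" using k by (auto simp: range a_def)
  have letter: "act N l \<in> ?S" for l by (rule image_eqI[of _ _ "[l]"]) auto
  have pow_add: "(act N l ^^ j) (x + y) = (act N l ^^ j) x + (act N l ^^ j) y" for l j x y
    using foldr_act_add[of N "replicate j l" x y] by (simp only: foldr_replicate)
  show ?thesis
  proof (rule witness_from_module[where \<psi> = \<psi> and S = ?S and f = "act N (False, True)"
        and g = "act N (True, True)" and g' = "act N (True, False)" and r = 2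
        and a = a and b = "- ((a + a + a) + (a + a + a))" and c = a])
    show "id \<in> ?S" by (rule image_eqI[of _ _ "[]"]) auto
    show "s \<circ> t \<in> ?S" if st: "s \<in> ?S" "t \<in> ?S" for s t
    proof -
      obtain us vs where uv: "s = foldr (act N) us" "t = foldr (act N) vs" using st by blast
      have "s \<circ> t = foldr (act N) (us @ vs)" unfolding uv by (simp add: fun_eq_iff)
      then show ?thesis by blast
    qed
    show "\<exists>t\<in>?S. s \<circ> t = id \<and> t \<circ> s = id" if st: "s \<in> ?S" for s
    proof -
      obtain us where us: "s = foldr (act N) us" using st by blast
      show ?thesis
        using foldr_inverse_word[of "act N", OF act_flip] unfolding us
        by (intro bexI[of _ "foldr (act N) (inverse_word us)"]) (auto simp: fun_eq_iff)
    qed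
    show "s (x + y) = s x + s y" if "s \<in> ?S" for s x y
      using that foldr_act_add by blast
    show "s (\<psi> v) \<in> range \<psi>" if s: "s \<in> ?S" for s v
    proof -
      obtain us where us: "s = foldr (act N) us" using s by blast
      have "\<psi> v \<in> range \<psi>" by simp
      then show ?thesis unfolding range us foldr_act by (auto simp: foldr_sl2_zero)
    qed
    show "s \<circ> \<psi> = \<psi>" if s: "s \<in> ?S" "s (\<psi> v) = \<psi> v" "v \<noteq> 0" for s v
    proof -
      obtain ws where ws: "s = foldr (act N) ws" using s by blast
      obtain us where us: "reduced us" "s = foldr (act N) us"
        using exists_reduced[of ws] act_flip unfolding ws by blast
      have "us = []"
        using foldr_act_no_fixed[OF emb us(1) _ \<psi>_nz[OF s(3)]] s(2) us(2) by blast
      then show ?thesis using us by auto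
    qed
    show "act N (False, True) ^^ n \<circ> act N (True, True) ^^ l \<circ> \<psi> \<noteq>
        act N (True, True) ^^ l \<circ> act N (False, True) ^^ n \<circ> \<psi>" if "1 \<le> n" "1 \<le> l" for n l
    proof
      assume eq: "act N (False, True) ^^ n \<circ> act N (True, True) ^^ l \<circ> \<psi> =
        act N (True, True) ^^ l \<circ> act N (False, True) ^^ n \<circ> \<psi>"
      obtain v where v: "a = \<psi> v" using a_range by blast
      let ?x = "(act N (False, True) ^^ n) ((act N (True, True) ^^ l) a)"
      have zero: "(act N k ^^ j) 0 = 0" for k j using pow_add[of j k 0 0] by simp
      have "?x \<noteq> 0"
      proof
        assume "?x = 0"
        then have "(act N (True, False) ^^ l) ((act N (False, False) ^^ n) ?x) = 0"
          by (simp add: zero)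
        then have "a = 0"
          using funpow_act_inverse[of n N "(False, False)"] funpow_act_inverse[of l N "(True, False)"]
          by simp
        then show False by (auto simp: a_def zero_prod_def zero_fun_def fun_eq_iff split: if_splits)
      qed
      moreover have "?x = (act N (True, True) ^^ l) ((act N (False, True) ^^ n) a)"
        using fun_cong[OF eq, of v] by (simp add: v)
      ultimately show False
        using act_powers_not_commuting[OF emb that] by blast
    qed
    show "a + (act N (True, True) ^^ j) (act N (False, True) ((act N (True, False) ^^ j)
        (- (a + a + a + (a + a + a))))) +
      (act N (True, True) ^^ j) ((act N (False, True) ^^ 2) ((act N (True, False) ^^ j) a)) = 0" for j
    proof -
      define z where "z = (act N (True, False) ^^ j) a"
      have az: "a = (act N (True, True) ^^ j) z"
        using funpow_act_inverse[of j N "(True, True)" a] by (simp add: z_def)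
      interpret p: additive "act N (True, False) ^^ j" by standard (rule pow_add)
      interpret q: additive "act N (True, True) ^^ j" by standard (rule pow_add)
      have b: "(act N (True, False) ^^ j) (- (a + a + a + (a + a + a))) = - (z + z + z + (z + z + z))"
        by (simp only: p.minus p.add z_def)
      have "fst z = 0"
        using arg_cong[OF foldr_act[of N "replicate j (True, False)" a], of fst]
        by (simp add: z_def a_def foldr_replicate)
      moreover have "snd z p + sl2 (False, True) (- (snd z p + snd z p + snd z p + (snd z p + snd z p + snd z p))) +
          sl2 (False, True) (sl2 (False, True) (snd z p)) = 0" for p
        by (rule sl2_relation[OF refl])
      ultimately have rel: "z + act N (False, True) (- (z + z + z + (z + z + z))) +
          act N (False, True) (act N (False, True) z) = 0"
        by (simp add: act_def prod_eq_iff fun_eq_iff)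
      show ?thesis
        unfolding b z_def[symmetric]
        by (subst az) (simp only: numeral_2_eq_2 funpow.simps comp_apply id_apply pow_add[symmetric] rel q.zero)
    qed
    show "act N (True, True) \<circ> act N (True, False) = id"
      "act N (True, False) \<circ> act N (True, True) = id"
      by (rule ext, use act_flip[of N "(True, True)"] act_flip[of N "(True, False)"] in simp)+
  qed (use letter \<psi> a_range k in
      \<open>auto simp: fun_eq_iff range a_def zero_prod_def zero_fun_def split: if_splits\<close>)
qed

section \<open>Dimension nine\<close>

definition left_mult :: "cycalg \<Rightarrow> cycalg \<times> (nat \<Rightarrow> int \<times> int) \<Rightarrow> cycalg \<times> (nat \<Rightarrow> int \<times> int)" where
  "left_mult u x = (u * fst x, snd x)"

lemma left_mult_funpow: "left_mult u ^^ n = left_mult (u ^ n)"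
  by (induction n) (auto simp: left_mult_def fun_eq_iff mult.assoc)

text \<open>The group consists of all units of the order, because the relation holds for
  \<open>gen\<close> while the free group contains only powers of \<open>gen ^ N\<close>. Freeness
  of the action follows from the absence of zero divisors alone; the free group serves to show that
  no positive powers of \<open>gen\<close> and of the conjugated generator commute.\<close>

lemma nine_witness:
  assumes card: "CARD('n::finite) = 9"
  shows "\<exists>\<Gamma>. subgroup \<Gamma> (torus_Aut :: ('n torus \<Rightarrow> 'n torus) monoid) \<and>
           \<not> virtually_abelian ((torus_Aut :: ('n torus \<Rightarrow> 'n torus) monoid)\<lparr>carrier := \<Gamma>\<rparr>) \<and>
           mixing torus_measure \<Gamma> \<and>
           \<not> mixing_of_order 3 torus_measure \<Gamma>"
proof -
  have card': "CARD('n) = 9 + 2 * 0" using card by simp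
  obtain t N where emb: "real_embedding t N" using exists_real_embedding by blast
  obtain \<psi> :: "int ^ 'n \<Rightarrow> cycalg \<times> (nat \<Rightarrow> int \<times> int)"
    where \<psi>: "\<And>v w. \<psi> (v + w) = \<psi> v + \<psi> w" "inj \<psi>"
      and r0: "range \<psi> = {x. ((9 :: nat) = 0 \<longrightarrow> fst x = 0) \<and> (\<forall>p\<ge>0. snd x p = 0)}"
    by (rule exists_coordinates[OF card' disjI2[OF refl]], rule that; blast)
  have range: "range \<psi> = {x. snd x = 0}"
    unfolding r0 by (simp add: fun_eq_iff zero_fun_def)
  let ?S = "{left_mult u |u. \<exists>v. u * v = 1 \<and> v * u = 1}"
  let ?B = "unit_of N (True, True)" and ?C = "unit_of N (True, False)"
  have BC: "?B * ?C = 1" "?C * ?B = 1"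
    using unit_of_flip[of N "(True, True)"] unit_of_flip[of N "(True, False)"] by simp_all
  have comp: "left_mult u \<circ> left_mult v = left_mult (u * v)" for u v
    by (auto simp: left_mult_def mult.assoc)
  have one: "left_mult 1 = id" by (auto simp: left_mult_def)
  show ?thesis
  proof (rule witness_from_module[where \<psi> = \<psi> and S = ?S and f = "left_mult gen"
        and g = "left_mult ?B" and g' = "left_mult ?C" and r = 3
        and a = "(1, 0)" and b = "(- 3, 0)" and c = "(1, 0)"])
    show "id \<in> ?S" using one by (metis (mono_tags, lifting) mem_Collect_eq mult_1)
    show "s \<circ> t \<in> ?S" if st: "s \<in> ?S" "t \<in> ?S" for s t
    proof -
      obtain u u' v v' where "s = left_mult u" "t = left_mult v" "u * u' = 1" "u' * u = 1"
        "v * v' = 1" "v' * v = 1" using st by blast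
      moreover from this have "u * v * (v' * u') = 1" "v' * u' * (u * v) = 1"
        by (metis mult.assoc mult_1)+
      ultimately show ?thesis using comp by blast
    qed
    show "\<exists>t\<in>?S. s \<circ> t = id \<and> t \<circ> s = id" if st: "s \<in> ?S" for s
    proof -
      obtain u v where "s = left_mult u" "u * v = 1" "v * u = 1" using st by blast
      then show ?thesis by (intro bexI[of _ "left_mult v"]) (auto simp: comp one)
    qed
    show "s (x + y) = s x + s y" if "s \<in> ?S" for s x y
      using that by (auto simp: left_mult_def distrib_left)
    show "s (\<psi> v) \<in> range \<psi>" if "s \<in> ?S" for s v
      using that rangeI[of \<psi> v] unfolding range by (auto simp: left_mult_def)
    show "s \<circ> \<psi> = \<psi>" if s: "s \<in> ?S" "s (\<psi> v) = \<psi> v" "v \<noteq> 0" for s v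
    proof -
      obtain u where u: "s = left_mult u" using s by blast
      have "\<psi> 0 = 0" using \<psi>(1)[of 0 0] by simp
      then have "\<psi> v \<noteq> 0" using s(3) \<psi>(2) by (metis injD)
      moreover have "snd (\<psi> v) = 0" using rangeI[of \<psi> v] unfolding range by simp
      ultimately have "fst (\<psi> v) \<noteq> 0" by (auto simp: prod_eq_iff)
      moreover have "(u - 1) * fst (\<psi> v) = 0"
        using s(2) by (simp add: u left_mult_def prod_eq_iff left_diff_distrib)
      ultimately have "u = 1" using cycalg_no_zero_divisors by force
      then show ?thesis by (simp add: u one)
    qed
    show "left_mult gen ^^ n \<circ> left_mult ?B ^^ m \<circ> \<psi> \<noteq> left_mult ?B ^^ m \<circ> left_mult gen ^^ n \<circ> \<psi>"
      if "1 \<le> n" "1 \<le> m" for n m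
    proof
      assume eq: "left_mult gen ^^ n \<circ> left_mult ?B ^^ m \<circ> \<psi> =
        left_mult ?B ^^ m \<circ> left_mult gen ^^ n \<circ> \<psi>"
      obtain v where v: "\<psi> v = (1, 0)" using range by (metis (mono_tags, lifting) mem_Collect_eq rangeE snd_conv)
      have "gen ^ n * ?B ^ m = ?B ^ m * gen ^ n"
        using fun_cong[OF eq, of v] by (simp add: left_mult_funpow v) (simp add: left_mult_def)
      \<comment> \<open>Passing to the \<open>N\<close>-th power replaces \<open>gen\<close> by a
        generator of the free group.\<close>
      then have *: "(gen ^ n) ^ N * ?B ^ m = ?B ^ m * (gen ^ n) ^ N"
        by (rule power_commuting_commutes)
      have act: "(act N l ^^ j) (v, 0) = (unit_of N l ^ j * v, 0)" for l j v
      proof -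
        have "sl2 l 0 = 0" by (simp add: sl2_zero_iff)
        then show ?thesis
          by (induction j) (simp_all add: act_def zero_fun_def mult.assoc)
      qed
      have gN: "unit_of N (False, True) ^ n = (gen ^ n) ^ N"
        by (simp add: mult.commute flip: power_mult)
      have nz: "(gen ^ n) ^ N * ?B ^ m \<noteq> 0"
      proof
        assume "(gen ^ n) ^ N * ?B ^ m = 0"
        then have "(gen ^ n) ^ N * (?B ^ m * ?C ^ m) = 0" by (simp flip: mult.assoc)
        then have "gen ^ (n * N) = 0" by (simp add: power_inverse[OF BC(1)] power_mult del: unit_of.simps)
        then have "gen ^ (n * N) * gen_inv ^ (n * N) = 0" by simp
        then show False using power_inverse[OF gen_inverse(1)] by simp
      qed
      show False
        by (rule act_powers_not_commuting[OF emb that,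
              where x = "((gen ^ n) ^ N * ?B ^ m, 0)" and y = "(1, 0)"])
          (use nz * in \<open>auto simp: act gN zero_prod_def simp del: unit_of.simps\<close>)
    qed
    show "(1, 0) + (left_mult ?B ^^ j) (left_mult gen ((left_mult ?C ^^ j) (- 3, 0))) +
        (left_mult ?B ^^ j) ((left_mult gen ^^ 3) ((left_mult ?C ^^ j) (1, 0))) = 0" for j
    proof -
      \<comment> \<open>Integers are central; this is what makes the relation stable under
        conjugation.\<close>
      have comm: "?C ^ j * (- 3) = (- 3) * ?C ^ j"
        by (metis mult_of_int_commute of_int_minus of_int_numeral)
      have "1 + ?B ^ j * (gen * (?C ^ j * (- 3))) + ?B ^ j * (gen ^ 3 * ?C ^ j) =
          ?B ^ j * (1 + gen * (- 3) + gen * gen * gen) * ?C ^ j"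
        unfolding comm distrib_left distrib_right power3_eq_cube
        by (simp only: mult.assoc mult_1 mult_1_right power_inverse[OF BC(1)])
      also have "\<dots> = 0" by (simp only: gen_relation mult_zero_left mult_zero_right)
      finally show ?thesis
        by (simp add: left_mult_funpow del: unit_of.simps)
          (simp add: left_mult_def zero_prod_def del: unit_of.simps)
    qed
    show "(- 3 :: cycalg, 0 :: nat \<Rightarrow> int \<times> int) \<noteq> 0"
      by (simp add: three_cycalg zero_prod_def zero_cycalg_def zero_cubic_def)
  qed (use \<psi> range BC gen_inverse comp one in
      \<open>auto simp: zero_prod_def simp del: unit_of.simps\<close>)
qed

theorem theorem1p16:
  assumes "CARD('n::finite) \<ge> 2" and "CARD('n) \<notin> {3, 5, 7}"
  shows "\<exists>\<Gamma>. subgroup \<Gamma> (torus_Aut :: ('n torus \<Rightarrow> 'n torus) monoid) \<and>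
           \<not> virtually_abelian ((torus_Aut :: ('n torus \<Rightarrow> 'n torus) monoid)\<lparr>carrier := \<Gamma>\<rparr>) \<and>
           mixing torus_measure \<Gamma> \<and>
           \<not> mixing_of_order 3 torus_measure \<Gamma>"
proof -
  \<comment> \<open>Even dimensions, dimension nine, and odd dimensions from eleven on.\<close>
  have "(CARD('n) = 0 + 2 * (CARD('n) div 2) \<and> 1 \<le> CARD('n) div 2) \<or> CARD('n) = 9 \<or>
      (CARD('n) = 9 + 2 * ((CARD('n) - 9) div 2) \<and> 1 \<le> (CARD('n) - 9) div 2)"
    using assms by simp presburger
  then show ?thesis
    using words_witness nine_witness by blast
qed

end
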